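(* Let $A=A_0[D_+,D_-]$, where $A_0\cong\mathbb{C}[t]$ and $D_+,D_-$ are $\mathbb{Q}$-divisors on $\mathbb{A}^1_{\mathbb{C}}=\operatorname{Spec}A_0$ with $D_++D_-\le0$. Then the following conditions are equivalent. (i) $D_+$ is integral, i.e. $\{D_+\}=0$. (ii) $A_{\ge0}\cong A_0[u]$ as graded $A_0$-algebras, where $\deg u=1$. (iii) $A\cong A_{d,P}$ as graded $A_0$-algebras (for some integer $d\ge1$ and some monic polynomial $P\in\mathbb{C}[t]$), where $D_++D_-=-\frac{\operatorname{div}P}{d}$.
   Context: For a $\mathbb{Q}$-divisor $D=\sum D(a)\,a$, $\lfloor D\rfloor=\sum\lfloor D(a)\rfloor a$ and $\{D\}=D-\lfloor D\rfloor$. For $\mathbb{Q}$-divisors with $D_++D_-\le0$, the normal graded $A_0$-algebra $A_0[D_+,D_-]=\bigoplus_{n\in\mathbb{Z}}A_n\subseteq\operatorname{Frac}(A_0)[u,u^{-1}]$ ($u$ an indeterminate of degree $1$) is defined by $A_n=H^0(\mathbb{A}^1_{\mathbb{C}},\mathcal{O}(\lfloor nD_+\rfloor))\cdot u^n$ and $A_{-n}=H^0(\mathbb{A}^1_{\mathbb{C}},\mathcal{O}(\lfloor nD_-\rfloor))\cdot u^{-n}$ for $n\ge0$; $A_{\ge0}=\bigoplus_{n\ge0}A_n$. For a monic polynomial $P\in\mathbb{C}[t]$ and $d\ge1$, $A_{d,P}$ denotes the normalization of $B_{d,P}:=\mathbb{C}[t,u,v]/(u^dv-P(t))$, graded via $\deg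 t=0$, $\deg u=1$, $\deg v=-d$. *)

theory Defs
  imports
    "HOL-Algebra.Algebraic_Closure_Type"
    "HOL-Computational_Algebra.Computational_Algebra"
    "HOL-Library.Poly_Mapping"
begin

text \<open>
  Throughout, \<open>A\<^sub>0\<close> is the type \<^typ>\<open>complex poly\<close> (the polynomial ring \<open>C[t]\<close>),
  \<open>Frac A\<^sub>0\<close> is \<^typ>\<open>complex poly fract\<close>, and closed points of the affine line
  are complex numbers.
\<close>

type_synonym qdivisor = "complex \<Rightarrow>\<^sub>0 rat"

definition qdiv_floor :: "qdivisor \<Rightarrow> qdivisor"
  where "qdiv_floor D = Poly_Mapping.map (\<lambda>x. of_int \<lfloor>x\<rfloor>) D"

definition qdiv_frac :: "qdivisor \<Rightarrow> qdivisor"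
  where "qdiv_frac D = D - qdiv_floor D"

definition qdiv_scale :: "rat \<Rightarrow> qdivisor \<Rightarrow> qdivisor"
  where "qdiv_scale c D = Poly_Mapping.map (\<lambda>x. c * x) D"

text \<open>
  The order relation on divisors is coefficientwise; it is not the (lexicographic) instance
  of \<open>\<le>\<close> that \<^theory>\<open>HOL-Library.Poly_Mapping\<close> provides.
\<close>

definition qdiv_le :: "qdivisor \<Rightarrow> qdivisor \<Rightarrow> bool"
  where "qdiv_le D E \<longleftrightarrow> (\<forall>a. Poly_Mapping.lookup D a \<le> Poly_Mapping.lookup E a)"

lemma lookup_qdiv_floor: "Poly_Mapping.lookup (qdiv_floor D) a = of_int \<lfloor>Poly_Mapping.lookup D a\<rfloor>"
  by (simp add: qdiv_floor_def Poly_Mapping.map.rep_eq when_def)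

lemma lookup_qdiv_frac: "Poly_Mapping.lookup (qdiv_frac D) a = frac (Poly_Mapping.lookup D a)"
  by (simp add: qdiv_frac_def Poly_Mapping.lookup_minus lookup_qdiv_floor frac_def)

lemma lookup_qdiv_scale: "Poly_Mapping.lookup (qdiv_scale c D) a = c * Poly_Mapping.lookup D a"
  by (simp add: qdiv_scale_def Poly_Mapping.map.rep_eq when_def)

text \<open>Order of vanishing at \<open>a\<close> of a nonzero rational function \<open>p/q\<close>.\<close>

definition ord_at :: "complex \<Rightarrow> complex poly fract \<Rightarrow> int"
  where "ord_at a f = (THE k. \<exists>p q. p \<noteq> 0 \<and> q \<noteq> 0 \<and> f = Fraction_Field.Fract p q \<and>
           k = int (Polynomial.order a p) - int (Polynomial.order a q))"

lemma ord_at_Fract: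
  assumes "p \<noteq> 0" "q \<noteq> 0"
  shows "ord_at a (Fraction_Field.Fract p q) = int (Polynomial.order a p) - int (Polynomial.order a q)"
  unfolding ord_at_def
proof (rule the_equality)
  show "\<exists>p' q'. p' \<noteq> 0 \<and> q' \<noteq> 0 \<and> Fraction_Field.Fract p q = Fraction_Field.Fract p' q' \<and>
      int (Polynomial.order a p) - int (Polynomial.order a q) = int (Polynomial.order a p') - int (Polynomial.order a q')"
    using assms by blast
next
  fix k
  assume "\<exists>p' q'. p' \<noteq> 0 \<and> q' \<noteq> 0 \<and> Fraction_Field.Fract p q = Fraction_Field.Fract p' q' \<and>
      k = int (Polynomial.order a p') - int (Polynomial.order a q')"
  then obtain p' q' where *: "p' \<noteq> 0" "q' \<noteq> 0" "p * q' = p' * q"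
      "k = int (Polynomial.order a p') - int (Polynomial.order a q')"
    using assms by (auto simp: eq_fract)
  have "Polynomial.order a (p * q') = Polynomial.order a (p' * q)"
    using * by simp
  then have "Polynomial.order a p + Polynomial.order a q' = Polynomial.order a p' + Polynomial.order a q"
    using * assms Polynomial.order_mult[of p q' a] Polynomial.order_mult[of p' q a] by simp
  then show "k = int (Polynomial.order a p) - int (Polynomial.order a q)"
    using * by linarith
qed

definition principal_qdiv :: "complex poly fract \<Rightarrow> qdivisor"
  where "principal_qdiv f = Abs_poly_mapping (\<lambda>a. if f = 0 then 0 else of_int (ord_at a f))"

lemma lookup_principal_qdiv:
  assumes "f \<noteq> 0"
  shows "Poly_Mapping.lookup (principal_qdiv f) a = of_int (ord_at a f)"
proof -
  obtain p q where pq: "f = Fraction_Field.Fract p q" "q \<noteq> 0"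
    by (cases f) auto
  have p: "p \<noteq> 0"
    using assms pq by (auto simp: fract_collapse)
  have "{a. (of_int (ord_at a f) :: rat) \<noteq> 0} \<subseteq> {a. poly p a = 0} \<union> {a. poly q a = 0}"
    using p pq by (auto simp: ord_at_Fract order_root)
  moreover have "finite ({a. poly p a = 0} \<union> {a. poly q a = 0})"
    using p pq by (simp add: poly_roots_finite)
  ultimately have "finite {a. (of_int (ord_at a f) :: rat) \<noteq> 0}"
    by (rule finite_subset)
  then show ?thesis
    using assms by (simp add: principal_qdiv_def Abs_poly_mapping_inverse)
qed

text \<open>Global sections \<open>H\<^sup>0(A\<^sup>1, O(E))\<close> of an integral divisor, as a subset of \<open>Frac A\<^sub>0\<close>.\<close>

definition H0 :: "qdivisor \<Rightarrow> complex poly fract set"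
  where "H0 E = {f. f = 0 \<or> qdiv_le 0 (principal_qdiv f + E)}"

text \<open>
  \<open>gpart R n\<close> is the homogeneous piece of degree \<open>n\<close>. The scalars form a type \<^typ>\<open>'k\<close>.
\<close>

record ('k, 'a) graded_algebra = "('k, 'a) module" +
  gpart :: "int \<Rightarrow> 'a set"

definition graded_algebra_iso ::
    "('k, 'a) graded_algebra \<Rightarrow> ('k, 'b) graded_algebra \<Rightarrow> ('a \<Rightarrow> 'b) set"
  where "graded_algebra_iso R S =
    {f \<in> ring_iso R S.
       (\<forall>c. \<forall>x\<in>carrier R. f (c \<odot>\<^bsub>R\<^esub> x) = c \<odot>\<^bsub>S\<^esub> f x) \<and>
       (\<forall>n. f ` gpart R n = gpart S n)}"

definition graded_isomorphic ::
    "('k, 'a) graded_algebra \<Rightarrow> ('k, 'b) graded_algebra \<Rightarrow> bool"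
  where "graded_isomorphic R S \<longleftrightarrow> graded_algebra_iso R S \<noteq> {}"

text \<open>
  The Laurent polynomial ring \<open>(Frac A\<^sub>0)[u, u\<^sup>-\<^sup>1]\<close> is the group algebra of the integers over
  \<open>Frac A\<^sub>0\<close>; \<^term>\<open>Poly_Mapping.single n f\<close> is the monomial \<open>f u\<^sup>n\<close>.
  Inside it, \<open>dpd_algebra D\<^sub>+ D\<^sub>-\<close> is \<open>A\<^sub>0[D\<^sub>+, D\<^sub>-]\<close>.
\<close>

type_synonym laurent = "int \<Rightarrow>\<^sub>0 complex poly fract"

definition dpd_coeffs :: "qdivisor \<Rightarrow> qdivisor \<Rightarrow> int \<Rightarrow> complex poly fract set"
  where "dpd_coeffs Dp Dm n =
    (if 0 \<le> n then H0 (qdiv_floor (qdiv_scale (of_int n) Dp))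
     else H0 (qdiv_floor (qdiv_scale (of_int (- n)) Dm)))"

definition dpd_piece :: "qdivisor \<Rightarrow> qdivisor \<Rightarrow> int \<Rightarrow> laurent set"
  where "dpd_piece Dp Dm n = Poly_Mapping.single n ` dpd_coeffs Dp Dm n"

definition dpd_algebra :: "qdivisor \<Rightarrow> qdivisor \<Rightarrow> (complex poly, laurent) graded_algebra"
  where "dpd_algebra Dp Dm =
    \<lparr>carrier = {x. \<forall>n. Poly_Mapping.lookup x n \<in> dpd_coeffs Dp Dm n},
     monoid.mult = (*), one = 1, zero = 0, add = (+),
     module.smult = (\<lambda>p x. Poly_Mapping.single 0 (to_fract p) * x),
     gpart = dpd_piece Dp Dm\<rparr>"

definition nonneg_part :: "(complex poly, laurent) graded_algebra \<Rightarrow> (complex poly, laurent) graded_algebra"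
  where "nonneg_part R =
    R\<lparr>carrier := {x \<in> carrier R. \<forall>n<0. Poly_Mapping.lookup x n = 0},
      gpart := (\<lambda>n. if 0 \<le> n then gpart R n else {0})\<rparr>"

definition poly_algebra :: "(complex poly, complex poly poly) graded_algebra"
  where "poly_algebra =
    \<lparr>carrier = UNIV, monoid.mult = (*), one = 1, zero = 0, add = (+),
     module.smult = Polynomial.smult,
     gpart = (\<lambda>n. if 0 \<le> n then range (\<lambda>p. Polynomial.monom p (nat n)) else {0})\<rparr>"

definition fraction_rel :: "('a, 'm) ring_scheme \<Rightarrow> (('a \<times> 'a) \<times> ('a \<times> 'a)) set"
  where "fraction_rel R =
    {((a, b), (c, d)). a \<in> carrier R \<and> b \<in> carrier R - {\<zero>\<^bsub>R\<^esub>} \<and>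
       c \<in> carrier R \<and> d \<in> carrier R - {\<zero>\<^bsub>R\<^esub>} \<and> a \<otimes>\<^bsub>R\<^esub> d = c \<otimes>\<^bsub>R\<^esub> b}"

definition fraction :: "('a, 'm) ring_scheme \<Rightarrow> 'a \<Rightarrow> 'a \<Rightarrow> ('a \<times> 'a) set"
  where "fraction R a b = fraction_rel R `` {(a, b)}"

definition fraction_field :: "('a, 'm) ring_scheme \<Rightarrow> ('a \<times> 'a) set ring"
  where "fraction_field R =
    \<lparr>carrier = {fraction R a b | a b. a \<in> carrier R \<and> b \<in> carrier R - {\<zero>\<^bsub>R\<^esub>}},
     monoid.mult = (\<lambda>S T. \<Union>(a, b)\<in>S. \<Union>(c, d)\<in>T. fraction R (a \<otimes>\<^bsub>R\<^esub> c) (b \<otimes>\<^bsub>R\<^esub> d)),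
     one = fraction R \<one>\<^bsub>R\<^esub> \<one>\<^bsub>R\<^esub>,
     zero = fraction R \<zero>\<^bsub>R\<^esub> \<one>\<^bsub>R\<^esub>,
     add = (\<lambda>S T. \<Union>(a, b)\<in>S. \<Union>(c, d)\<in>T.
              fraction R ((a \<otimes>\<^bsub>R\<^esub> d) \<oplus>\<^bsub>R\<^esub> (c \<otimes>\<^bsub>R\<^esub> b)) (b \<otimes>\<^bsub>R\<^esub> d))\<rparr>"

definition to_fraction :: "('a, 'm) ring_scheme \<Rightarrow> 'a \<Rightarrow> ('a \<times> 'a) set"
  where "to_fraction R a = fraction R a \<one>\<^bsub>R\<^esub>"

text \<open>
  In \<^theory>\<open>HOL-Algebra.Polynomials\<close>, polynomials are coefficient lists with the leading coefficient at the head.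
\<close>

definition integral_closure :: "('a, 'm) ring_scheme \<Rightarrow> 'a set \<Rightarrow> 'a set"
  where "integral_closure K S =
    {x \<in> carrier K. \<exists>p. polynomial\<^bsub>K\<^esub> S p \<and> p \<noteq> [] \<and> hd p = \<one>\<^bsub>K\<^esub> \<and>
       ring.eval K p x = \<zero>\<^bsub>K\<^esub>}"

definition normalization :: "('a, 'm) ring_scheme \<Rightarrow> ('a \<times> 'a) set ring"
  where "normalization R =
    (fraction_field R)\<lparr>carrier := integral_closure (fraction_field R) (to_fraction R ` carrier R)\<rparr>"

text \<open>
  \<open>C[t,u,v]\<close> is realised as \<open>C[t][u][v]\<close>, so \<open>v\<close> is the outermost indeterminate;
  \<open>B_ring d P\<close> is \<open>C[t,u,v]/(u\<^sup>dv - P(t))\<close> and \<open>A_dP d P\<close> its normalization.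
\<close>

definition const_tuv :: "complex poly \<Rightarrow> complex poly poly poly"
  where "const_tuv p = [:[:p:]:]"

definition u_tuv :: "complex poly poly poly"
  where "u_tuv = [:[:0, 1:]:]"

definition v_tuv :: "complex poly poly poly"
  where "v_tuv = [:0, 1:]"

definition B_ideal :: "nat \<Rightarrow> complex poly \<Rightarrow> complex poly poly poly set"
  where "B_ideal d P = PIdl\<^bsub>ring_of_type_algebra\<^esub> (u_tuv ^ d * v_tuv - const_tuv P)"

definition B_ring :: "nat \<Rightarrow> complex poly \<Rightarrow> complex poly poly poly set ring"
  where "B_ring d P = ring_of_type_algebra Quot B_ideal d P"

definition B_class :: "nat \<Rightarrow> complex poly \<Rightarrow> complex poly poly poly \<Rightarrow> complex poly poly poly set"
  where "B_class d P f = B_ideal d P +>\<^bsub>ring_of_type_algebra\<^esub> f"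

text \<open>Homogeneity in \<open>C[t,u,v]\<close> for the weights \<open>deg t = 0\<close>, \<open>deg u = 1\<close>, \<open>deg v = -d\<close>.\<close>

definition homogeneous_tuv :: "nat \<Rightarrow> int \<Rightarrow> complex poly poly poly \<Rightarrow> bool"
  where "homogeneous_tuv d n f \<longleftrightarrow>
    (\<forall>i j. Polynomial.coeff (Polynomial.coeff f j) i \<noteq> 0 \<longrightarrow> int i - int d * int j = n)"

definition B_piece :: "nat \<Rightarrow> complex poly \<Rightarrow> int \<Rightarrow> complex poly poly poly set set"
  where "B_piece d P n = B_class d P ` {f. homogeneous_tuv d n f}"

text \<open>
  The grading of \<open>B\<^bsub>d,P\<^esub>\<close> extends to the localization at its nonzero homogeneous elements, with
  \<open>a/b\<close> of degree \<open>deg a - deg b\<close>; the normalization is a graded subring of that localization.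
\<close>

definition A_dP :: "nat \<Rightarrow> complex poly \<Rightarrow>
    (complex poly, (complex poly poly poly set \<times> complex poly poly poly set) set) graded_algebra"
  where "A_dP d P =
    (let B = B_ring d P; N = normalization B in
     \<lparr>carrier = carrier N, monoid.mult = monoid.mult N, one = one N, zero = zero N, add = add N,
      module.smult = (\<lambda>p x. to_fraction B (B_class d P (const_tuv p)) \<otimes>\<^bsub>N\<^esub> x),
      gpart = (\<lambda>n. carrier N \<inter>
        {fraction B a b | a b k m. a \<in> B_piece d P k \<and> b \<in> B_piece d P m - {\<zero>\<^bsub>B\<^esub>} \<and> k - m = n})\<rparr>)"

end

theory Submission
  imports Defs "Jordan_Normal_Form.Char_Poly"
begin

text \<open>
  The ring \<open>A\<^sub>0[D\<^sub>+, D\<^sub>-]\<close> is the intersection of the valuation rings of the Gauss-type valuations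
  \<open>\<Sum> f\<^sub>n u\<^sup>n \<mapsto> min\<^sub>n (ord\<^sub>a f\<^sub>n + r n)\<close> with \<open>r = D\<^sub>+(a)\<close> and \<open>r = - D\<^sub>-(a)\<close>.

  If \<open>D\<^sub>+\<close> is integral, choose \<open>g\<close> with \<open>div g = - D\<^sub>+\<close> and \<open>d\<close>, \<open>P\<close> with \<open>div P = - d (D\<^sub>+ + D\<^sub>-)\<close>. Sending
  \<open>u \<mapsto> g u\<close> and \<open>v \<mapsto> P (g u)\<^sup>-\<^sup>d\<close> embeds \<open>C[t,u,v]/(u\<^sup>d v - P)\<close> into the Laurent polynomials, with image in
  \<open>A\<close>. An element integral over the image is a Laurent polynomial (rational root argument in the
  factorial ring \<open>C[t][u]\<close>), and then lies in \<open>A\<close> because valuation rings are integrally closed.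
  Conversely \<open>A\<close> is spanned by homogeneous elements: those of degree \<open>n \<ge> 0\<close> lie in \<open>C[t] (g u)\<^sup>n\<close>, and
  the \<open>d\<close>-th power of one of degree \<open>- m < 0\<close> lies in \<open>C[t] v\<^sup>m\<close>. So \<open>A\<close> is the normalization.

  Both \<open>A\<^sub>0[u]\<close> and \<open>A\<^bsub>d,P\<^esub>\<close> have \<open>n\<close>-th piece \<open>A\<^sub>0 w\<^sup>n\<close> for all \<open>n \<ge> 0\<close>, and this property of a graded
  algebra forces \<open>\<lfloor>n D\<^sub>+\<rfloor> = n \<lfloor>D\<^sub>+\<rfloor>\<close> for all \<open>n\<close>.
\<close>

section \<open>Orders and Gauss valuations\<close>

lemma Fract_cases_nonzero:
  fixes f :: "'a::idom fract"
  assumes "f \<noteq> 0"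
  obtains p q where "p \<noteq> 0" "q \<noteq> 0" "f = Fraction_Field.Fract p q"
proof -
  obtain p q where pq: "f = Fraction_Field.Fract p q" "q \<noteq> 0"
    by (cases f) auto
  then have "p \<noteq> 0"
    using assms by (auto simp: fract_collapse)
  with pq that show thesis by blast
qed

lemma ord_at_to_fract: "p \<noteq> 0 \<Longrightarrow> ord_at a (to_fract p) = int (Polynomial.order a p)"
  by (simp add: to_fract_def ord_at_Fract)

lemma ord_at_1 [simp]: "ord_at a 1 = 0"
  using ord_at_to_fract[of 1 a] by simp

lemma ord_at_mult:
  assumes "f \<noteq> 0" "g \<noteq> 0"
  shows "ord_at a (f * g) = ord_at a f + ord_at a g"
proof -
  obtain p q where f: "p \<noteq> 0" "q \<noteq> 0" "f = Fraction_Field.Fract p q"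
    using assms(1) by (rule Fract_cases_nonzero)
  obtain r s where g: "r \<noteq> 0" "s \<noteq> 0" "g = Fraction_Field.Fract r s"
    using assms(2) by (rule Fract_cases_nonzero)
  show ?thesis
    using f g by (simp add: ord_at_Fract Polynomial.order_mult)
qed

lemma ord_at_inverse: "f \<noteq> 0 \<Longrightarrow> ord_at a (inverse f) = - ord_at a f"
  using ord_at_mult[of f "inverse f" a] by simp

lemma ord_at_divide:
  "f \<noteq> 0 \<Longrightarrow> g \<noteq> 0 \<Longrightarrow> ord_at a (f / g) = ord_at a f - ord_at a g"
  by (simp add: divide_inverse ord_at_mult ord_at_inverse)

lemma ord_at_uminus: "f \<noteq> 0 \<Longrightarrow> ord_at a (- f) = ord_at a f"
  using ord_at_mult[of "-1" f a] ord_at_mult[of "-1" "-1" a] by simp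

lemma ord_at_power: "f \<noteq> 0 \<Longrightarrow> ord_at a (f ^ n) = int n * ord_at a f"
  by (induction n) (simp_all add: ord_at_mult algebra_simps)

lemma order_add_ge:
  fixes p q :: "'a::idom poly"
  assumes "p + q \<noteq> 0" "p \<noteq> 0" "q \<noteq> 0"
  shows "min (Polynomial.order a p) (Polynomial.order a q) \<le> Polynomial.order a (p + q)"
  by (metis assms dvd_add min.cobounded1 min.cobounded2 order_divides)

lemma ord_at_add_ge:
  assumes "f + g \<noteq> 0" "f \<noteq> 0" "g \<noteq> 0"
  shows "min (ord_at a f) (ord_at a g) \<le> ord_at a (f + g)"
proof -
  obtain p q where f: "p \<noteq> 0" "q \<noteq> 0" "f = Fraction_Field.Fract p q"
    using assms(2) by (rule Fract_cases_nonzero)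
  obtain r s where g: "r \<noteq> 0" "s \<noteq> 0" "g = Fraction_Field.Fract r s"
    using assms(3) by (rule Fract_cases_nonzero)
  have fg: "f + g = Fraction_Field.Fract (p * s + r * q) (q * s)"
    using f g by simp
  with assms(1) f g have nz: "p * s + r * q \<noteq> 0"
    by (metis fract_collapse(1))
  have "min (Polynomial.order a (p * s)) (Polynomial.order a (r * q)) \<le> Polynomial.order a (p * s + r * q)"
    using nz f g by (intro order_add_ge) auto
  then show ?thesis
    using nz f g unfolding fg by (simp add: ord_at_Fract Polynomial.order_mult)
qed

section \<open>Divisibility and prescribed orders on the affine line\<close>

text \<open>Induction on the degree of \<open>q\<close>: over the complex numbers a nonconstant
  \<open>q\<close> has a root, the orders make it a root of \<open>p\<close> too, and the common
  linear factor is split off.\<close>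

lemma poly_dvd_of_order_le:
  fixes p q :: "complex poly"
  assumes "q \<noteq> 0" "\<And>a. Polynomial.order a q \<le> Polynomial.order a p"
  shows "q dvd p"
  using assms
proof (induction "Polynomial.degree q" arbitrary: p q)
  case 0
  then show ?case
    by (metis is_unit_iff_degree unit_imp_dvd)
next
  case (Suc n)
  then have "\<not> constant (poly q)"
    by (metis constant_degree nat.distinct(1))
  then obtain a where "poly q a = 0"
    using fundamental_theorem_of_algebra by blast
  then obtain q' where q': "q = [:-a, 1:] * q'"
    by (metis dvdE poly_eq_0_iff_dvd)
  show ?case
  proof (cases "p = 0")
    case False
    have "Polynomial.order a q \<noteq> 0"
      using \<open>poly q a = 0\<close> Suc by (metis order_root)
    then have "poly p a = 0"
      using Suc.prems(2)[of a] by (metis bot_nat_0.extremum_uniqueI order_root)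
    then obtain p' where p': "p = [:-a, 1:] * p'"
      by (metis dvdE poly_eq_0_iff_dvd)
    have nz: "q' \<noteq> 0" "p' \<noteq> 0"
      using False Suc.prems q' p' by auto
    have "q' dvd p'"
    proof (rule Suc.hyps(1))
      show "n = Polynomial.degree q'"
        using Suc.hyps(2) nz unfolding q' by (subst (asm) degree_mult_eq) auto
      show "Polynomial.order b q' \<le> Polynomial.order b p'" for b
        using Suc.prems(2)[of b] nz unfolding q' p' by (subst (asm) (1 2) Polynomial.order_mult) (auto simp del: mult_pCons_left)
    qed (use nz in auto)
    then show ?thesis unfolding q' p' by (rule mult_dvd_mono[OF dvd_refl])
  qed auto
qed

text \<open>Absence of poles means that the denominator divides the numerator, by comparison of
  orders.\<close>

lemma eq_to_fract_of_ord_at_nonneg: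
  assumes "\<And>a. f = 0 \<or> 0 \<le> ord_at a f"
  obtains p where "f = to_fract p"
proof (cases "f = 0")
  case True
  then show thesis using that[of 0] by simp
next
  case False
  obtain p q where f: "p \<noteq> 0" "q \<noteq> 0" "f = Fraction_Field.Fract p q"
    using False by (rule Fract_cases_nonzero)
  have "q dvd p"
    using f assms False by (intro poly_dvd_of_order_le) (auto simp: ord_at_Fract)
  then obtain r where "p = q * r" ..
  with f have "f = to_fract r"
    by (simp add: Fract_conv_to_fract)
  then show thesis by (rule that)
qed

text \<open>The witness is the product of the \<open>(t - a)^(k a)\<close> over \<open>a\<close> in
  \<open>S\<close>. It realises effective integral divisors as divisors of monic
  polynomials.\<close>

lemma exists_monic_with_orders:
  fixes k :: "complex \<Rightarrow> nat"
  assumes "finite S"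
  obtains P :: "complex poly" where "Polynomial.lead_coeff P = 1"
    "\<And>a. Polynomial.order a P = (if a \<in> S then k a else 0)"
proof -
  have "\<exists>P :: complex poly. Polynomial.lead_coeff P = 1 \<and> (\<forall>a. Polynomial.order a P = (if a \<in> S then k a else 0))"
    using assms
  proof (induction S)
    case empty
    show ?case by (rule exI[of _ 1]) simp
  next
    case (insert b S)
    then obtain P where P: "Polynomial.lead_coeff P = 1" "\<And>a. Polynomial.order a P = (if a \<in> S then k a else 0)"
      by blast
    let ?L = "[:- b, 1:] ^ k b"
    have L: "Polynomial.lead_coeff ?L = 1"
      by (simp add: lead_coeff_power)
    have nz: "P \<noteq> 0" "?L \<noteq> 0"
      using P(1) by auto
    have ob: "Polynomial.order a ?L = (if a = b then k b else 0)" for a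
    proof (cases "a = b")
      case False
      then have "poly ?L a \<noteq> 0" by simp
      with False show ?thesis by (metis order_root)
    qed (simp add: order_power_n_n)
    have "Polynomial.lead_coeff (?L * P) = 1"
      using P(1) L unfolding lead_coeff_mult by simp
    moreover have "Polynomial.order a (?L * P) = (if a \<in> insert b S then k a else 0)" for a
      using nz insert.hyps by (subst Polynomial.order_mult) (auto simp: ob P(2))
    ultimately show ?case by blast
  qed
  with that show thesis by blast
qed

text \<open>
  \<open>val_ge a r k x\<close> says that the Gauss-type valuation \<open>min\<^sub>n (ord\<^sub>a x\<^sub>n + r n)\<close> of \<open>x = \<Sum> x\<^sub>n u\<^sup>n\<close>
  is at least \<open>k\<close>.
\<close>

definition val_ge :: "complex \<Rightarrow> rat \<Rightarrow> rat \<Rightarrow> laurent \<Rightarrow> bool"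
  where "val_ge a r k x \<longleftrightarrow> (\<forall>n. Poly_Mapping.lookup x n \<noteq> 0 \<longrightarrow>
           k \<le> of_int (ord_at a (Poly_Mapping.lookup x n)) + r * of_int n)"

text \<open>Degrees form a group, so the degree in \<open>x\<close> determines the degree in
  \<open>y\<close>, and one finite sum over the support of \<open>x\<close> suffices.\<close>

lemma lookup_times_int:
  fixes x y :: "int \<Rightarrow>\<^sub>0 'a::comm_ring_1"
  shows "Poly_Mapping.lookup (x * y) n =
    (\<Sum>i\<in>Poly_Mapping.keys x. Poly_Mapping.lookup x i * Poly_Mapping.lookup y (n - i))"
proof -
  have "Poly_Mapping.lookup (x * y) n =
      (\<Sum>i. Poly_Mapping.lookup x i * (\<Sum>q. Poly_Mapping.lookup y q when n = i + q))"
    by (simp add: times_poly_mapping.rep_eq prod_fun_def)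
  also have "(\<lambda>i. Poly_Mapping.lookup x i * (\<Sum>q. Poly_Mapping.lookup y q when n = i + q)) =
      (\<lambda>i. Poly_Mapping.lookup x i * Poly_Mapping.lookup y (n - i))"
  proof
    fix i
    have "(\<lambda>q. Poly_Mapping.lookup y q when n = i + q) = (\<lambda>q. Poly_Mapping.lookup y q when q = n - i)"
      by (auto simp: when_def fun_eq_iff)
    then show "Poly_Mapping.lookup x i * (\<Sum>q. Poly_Mapping.lookup y q when n = i + q) =
        Poly_Mapping.lookup x i * Poly_Mapping.lookup y (n - i)"
      by (simp only: Sum_any_when_equal)
  qed
  also have "(\<Sum>i. Poly_Mapping.lookup x i * Poly_Mapping.lookup y (n - i)) =
      (\<Sum>i\<in>Poly_Mapping.keys x. Poly_Mapping.lookup x i * Poly_Mapping.lookup y (n - i))"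
    by (rule Sum_any.expand_superset) (auto simp: in_keys_iff)
  finally show ?thesis .
qed

lemma lookup_single_times:
  fixes y :: "int \<Rightarrow>\<^sub>0 'a::comm_ring_1"
  shows "Poly_Mapping.lookup (Poly_Mapping.single i c * y) n = c * Poly_Mapping.lookup y (n - i)"
  by (cases "c = 0") (simp_all add: lookup_times_int keys_single)

lemma single_power: "Poly_Mapping.single n c ^ k = Poly_Mapping.single (int k * n) (c ^ k)"
  by (induction k) (simp_all add: mult_single algebra_simps)

lemma ord_at_sum_gt:
  assumes "finite S" "\<And>i. i \<in> S \<Longrightarrow> f i = 0 \<or> k < (of_int (ord_at a (f i)) :: rat)" "sum f S \<noteq> 0"
  shows "k < of_int (ord_at a (sum f S))"
proof -
  have "sum f S = 0 \<or> k < of_int (ord_at a (sum f S))"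
    using assms(1,2)
  proof (induction S)
    case (insert i S)
    have fi: "f i = 0 \<or> k < of_int (ord_at a (f i))"
      using insert.prems by blast
    show ?case
    proof (cases "f i = 0 \<or> sum f S = 0 \<or> f i + sum f S = 0")
      case False
      then have "min (ord_at a (f i)) (ord_at a (sum f S)) \<le> ord_at a (f i + sum f S)"
        by (intro ord_at_add_ge) auto
      moreover have "k < of_int (min (ord_at a (f i)) (ord_at a (sum f S)))"
        using False insert by (auto simp: min_def)
      ultimately have "k < of_int (ord_at a (f i + sum f S))"
        by (meson less_le_trans of_int_le_iff)
      with insert show ?thesis by simp
    next
      case True
      have "sum f S = 0 \<or> k < of_int (ord_at a (sum f S))"
        using insert by blast
      with True fi insert.hyps show ?thesis by (elim disjE) simp_all
    qed
  qed simp
  with assms(3) show ?thesis by blast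
qed

lemma ord_at_sum_ge:
  assumes "finite S" "\<And>i. i \<in> S \<Longrightarrow> f i = 0 \<or> k \<le> (of_int (ord_at a (f i)) :: rat)" "sum f S \<noteq> 0"
  shows "k \<le> of_int (ord_at a (sum f S))"
proof (rule ccontr)
  assume *: "\<not> ?thesis"
  \<comment> \<open>The strict estimate is applied with the order of the sum itself as the bound,
    which by \<open>*\<close> lies below the order of every nonzero summand.\<close>
  have "of_int (ord_at a (sum f S)) < (of_int (ord_at a (sum f S)) :: rat)"
    using * assms by (intro ord_at_sum_gt) force+
  then show False by simp
qed

section \<open>Calculus of Gauss valuations\<close>

lemma val_ge_0 [simp]: "val_ge a r k 0"
  by (simp add: val_ge_def)

lemma val_ge_mono: "val_ge a r k x \<Longrightarrow> l \<le> k \<Longrightarrow> val_ge a r l x"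
  by (force simp: val_ge_def)

lemma val_ge_uminus: "val_ge a r k x \<Longrightarrow> val_ge a r k (- x)"
  by (auto simp: val_ge_def ord_at_uminus)

lemma val_ge_sum: 
  assumes "\<And>i. i \<in> S \<Longrightarrow> val_ge a r k (f i)"
  shows "val_ge a r k (sum f S)"
proof (cases "finite S")
  case True
  show ?thesis unfolding val_ge_def lookup_sum
  proof (intro allI impI)
    fix n
    assume nz: "(\<Sum>i\<in>S. Poly_Mapping.lookup (f i) n) \<noteq> 0"
    have "k - r * of_int n \<le> of_int (ord_at a (\<Sum>i\<in>S. Poly_Mapping.lookup (f i) n))"
    proof (rule ord_at_sum_ge[OF True _ nz])
      fix i assume "i \<in> S"
      from assms[OF this] show "Poly_Mapping.lookup (f i) n = 0 \<or>
          k - r * of_int n \<le> of_int (ord_at a (Poly_Mapping.lookup (f i) n))"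
        by (force simp: val_ge_def)
    qed
    then show "k \<le> of_int (ord_at a (\<Sum>i\<in>S. Poly_Mapping.lookup (f i) n)) + r * of_int n"
      by simp
  qed
qed simp

lemma val_ge_add: "val_ge a r k x \<Longrightarrow> val_ge a r k y \<Longrightarrow> val_ge a r k (x + y)"
  using val_ge_sum[of "{True, False}" a r k "\<lambda>b. if b then x else y"] by auto

lemma val_ge_mult:
  assumes "val_ge a r k x" "val_ge a r l y"
  shows "val_ge a r (k + l) (x * y)"
  unfolding val_ge_def
proof (intro allI impI)
  fix n
  assume nz: "Poly_Mapping.lookup (x * y) n \<noteq> 0"
  have "k + l - r * of_int n \<le> of_int (ord_at a (Poly_Mapping.lookup (x * y) n))"
    unfolding lookup_times_int
  proof (rule ord_at_sum_ge)
    fix i assume "i \<in> Poly_Mapping.keys x"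
    show "Poly_Mapping.lookup x i * Poly_Mapping.lookup y (n - i) = 0 \<or> k + l - r * of_int n
        \<le> of_int (ord_at a (Poly_Mapping.lookup x i * Poly_Mapping.lookup y (n - i)))"
    proof (cases "Poly_Mapping.lookup x i * Poly_Mapping.lookup y (n - i) = 0")
      case False
      then have "k \<le> of_int (ord_at a (Poly_Mapping.lookup x i)) + r * of_int i"
        "l \<le> of_int (ord_at a (Poly_Mapping.lookup y (n - i))) + r * of_int (n - i)"
        using assms by (auto simp: val_ge_def)
      with False show ?thesis by (simp add: ord_at_mult algebra_simps)
    qed simp
  qed (use nz in \<open>simp_all add: lookup_times_int\<close>)
  then show "k + l \<le> of_int (ord_at a (Poly_Mapping.lookup (x * y) n)) + r * of_int n"
    by simp
qed

lemma val_ge_single: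
  "val_ge a r k (Poly_Mapping.single n c) \<longleftrightarrow> c = 0 \<or> k \<le> of_int (ord_at a c) + r * of_int n"
  by (auto simp: val_ge_def lookup_single when_def)

lemma val_ge_1 [simp]: "val_ge a r 0 1"
  unfolding single_one[symmetric] val_ge_single by simp

lemma val_ge_power: "val_ge a r k x \<Longrightarrow> val_ge a r (of_nat n * k) (x ^ n)"
proof (induction n)
  case (Suc n)
  then show ?case
    using val_ge_mult[of a r k x "of_nat n * k" "x ^ n"] by (simp add: algebra_simps)
qed simp

text \<open>
  Recording the smallest degree \<open>j\<close> in which the valuation \<open>k\<close> is attained makes the property
  multiplicative, as in the proof of Gauss's lemma.
\<close>

definition val_leading :: "complex \<Rightarrow> rat \<Rightarrow> rat \<Rightarrow> int \<Rightarrow> laurent \<Rightarrow> bool"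
  where "val_leading a r k j x \<longleftrightarrow> val_ge a r k x \<and> Poly_Mapping.lookup x j \<noteq> 0 \<and>
    of_int (ord_at a (Poly_Mapping.lookup x j)) + r * of_int j = k \<and>
    (\<forall>i<j. Poly_Mapping.lookup x i \<noteq> 0 \<longrightarrow>
       k < of_int (ord_at a (Poly_Mapping.lookup x i)) + r * of_int i)"

lemma val_leading_exists:
  assumes "x \<noteq> 0"
  obtains k j where "val_leading a r k j x"
proof -
  define W where "W n = of_int (ord_at a (Poly_Mapping.lookup x n)) + r * of_int n" for n
  let ?K = "Poly_Mapping.keys x"
  have ne: "?K \<noteq> {}" using assms by simp
  define k where "k = Min (W ` ?K)"
  let ?J = "{n \<in> ?K. W n = k}"
  have "k \<in> W ` ?K" unfolding k_def using ne by (intro Min_in) auto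
  then have J: "?J \<noteq> {}" "finite ?J" by auto
  have kle: "k \<le> W n" if "n \<in> ?K" for n
    unfolding k_def using that by (intro Min_le) auto
  define j where "j = Min ?J"
  have jJ: "j \<in> ?J" unfolding j_def using J by (intro Min_in)
  have "W i \<noteq> k" if "i < j" "i \<in> ?K" for i
    using that Min_le[OF J(2), of i] unfolding j_def[symmetric] by auto
  then have "val_leading a r k j x"
    using jJ kle unfolding val_leading_def val_ge_def W_def
    by (fastforce simp: in_keys_iff less_le)
  then show thesis by (rule that)
qed

text \<open>In degree \<open>i + j\<close> the product of the two leading terms is the only one of
  value \<open>k + l\<close>: any other pair of degrees with sum at most \<open>i + j\<close> has
  one entry below \<open>i\<close> or \<open>j\<close>, where the value is strictly larger.\<close>

lemma val_leading_mult:
  assumes "val_leading a r k i x" "val_leading a r l j y"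
  shows "val_leading a r (k + l) (i + j) (x * y)"
proof -
  note xy = assms[unfolded val_leading_def]
  let ?x = "Poly_Mapping.lookup x" and ?y = "Poly_Mapping.lookup y"
  have term_gt: "k + l - r * of_int n < of_int (ord_at a (?x m * ?y (n - m)))"
    if nz: "?x m * ?y (n - m) \<noteq> 0" and n: "n \<le> i + j" "(m, n - m) \<noteq> (i, j)" for m n
  proof -
    have ge: "k \<le> of_int (ord_at a (?x m)) + r * of_int m"
      "l \<le> of_int (ord_at a (?y (n - m))) + r * of_int (n - m)"
      using xy nz by (auto simp: val_ge_def)
    have "m < i \<or> n - m < j" using n by auto
    then have "k < of_int (ord_at a (?x m)) + r * of_int m \<or>
      l < of_int (ord_at a (?y (n - m))) + r * of_int (n - m)"
      using xy nz by auto
    with ge nz show ?thesis by (auto simp: ord_at_mult algebra_simps)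
  qed
  let ?T = "\<lambda>m. ?x m * ?y (i + j - m)"
  have iK: "i \<in> Poly_Mapping.keys x" using xy by (auto simp: in_keys_iff)
  define s where "s = (\<Sum>m\<in>Poly_Mapping.keys x - {i}. ?T m)"
  have xij: "Poly_Mapping.lookup (x * y) (i + j) = ?x i * ?y j + s"
    unfolding lookup_times_int s_def using iK by (simp add: sum.remove)
  have s: "s = 0 \<or> k + l - r * of_int (i + j) < of_int (ord_at a s)"
    unfolding s_def using term_gt[of _ "i + j"] by (metis (no_types, lifting) DiffD2 Pair_inject
        finite_Diff finite_keys insertI1 order_refl ord_at_sum_gt)
  have ij: "?x i * ?y j \<noteq> 0" "of_int (ord_at a (?x i * ?y j)) = k + l - r * of_int (i + j)"
    using xy by (auto simp: ord_at_mult algebra_simps)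
  have nz: "?x i * ?y j + s \<noteq> 0"
  proof
    assume "?x i * ?y j + s = 0"
    then have "s = - (?x i * ?y j)" by (simp add: eq_neg_iff_add_eq_0 add.commute)
    with s ij show False by (auto simp: ord_at_uminus)
  qed
  have "of_int (ord_at a (?x i * ?y j + s)) = k + l - r * of_int (i + j)"
  proof (cases "s = 0")
    case False
    have "min (ord_at a (?x i * ?y j)) (ord_at a s) \<le> ord_at a (?x i * ?y j + s)"
      using nz False ij by (intro ord_at_add_ge) auto
    \<comment> \<open>Subtracting \<open>s\<close> again gives the opposite bound, so the summand of
      strictly smaller order determines the order of the sum.\<close>
    moreover have "min (ord_at a (?x i * ?y j + s)) (ord_at a (- s)) \<le> ord_at a (?x i * ?y j + s + - s)"
      using nz False ij by (intro ord_at_add_ge) auto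
    moreover have "ord_at a (?x i * ?y j) < ord_at a s"
    proof -
      have "of_int (ord_at a (?x i * ?y j)) < (of_int (ord_at a s) :: rat)" using s ij False by auto
      then show ?thesis by simp
    qed
    ultimately have "ord_at a (?x i * ?y j + s) = ord_at a (?x i * ?y j)"
      using False by (simp add: ord_at_uminus)
    then show ?thesis using ij by simp
  qed (use ij in simp)
  moreover have "k + l < of_int (ord_at a (Poly_Mapping.lookup (x * y) n)) + r * of_int n"
    if n: "n < i + j" "Poly_Mapping.lookup (x * y) n \<noteq> 0" for n
  proof -
    have "k + l - r * of_int n < of_int (ord_at a (Poly_Mapping.lookup (x * y) n))"
      unfolding lookup_times_int
    proof (rule ord_at_sum_gt)
      fix m
      show "?x m * ?y (n - m) = 0 \<or> k + l - r * of_int n < of_int (ord_at a (?x m * ?y (n - m)))"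
        using term_gt[of m n] n by auto
    qed (use n in \<open>simp_all add: lookup_times_int\<close>)
    then show ?thesis by simp
  qed
  ultimately show ?thesis
    using nz xy unfolding val_leading_def xij by (auto intro: val_ge_mult)
qed

lemma val_leading_power: "val_leading a r k j x \<Longrightarrow> val_leading a r (of_nat n * k) (int n * j) (x ^ n)"
proof (induction n)
  case 0
  have "Poly_Mapping.lookup 1 i = (0 :: complex poly fract)" if "i < 0" for i :: int
    using that by (simp add: lookup_one when_def)
  then show ?case by (auto simp: val_leading_def)
next
  case (Suc n)
  then show ?case
    using val_leading_mult[of a r k j x "of_nat n * k" "int n * j" "x ^ n"] by (simp add: algebra_simps)
qed

text \<open>Valuation rings are integrally closed: if \<open>x\<close> had value
  \<open>k < 0\<close>, then \<open>x^n\<close> would have value exactly \<open>n * k\<close>,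
  whereas the lower terms all have value at least \<open>(n - 1) * k\<close>, which is
  larger.\<close>

lemma val_ge_of_monic_relation:
  assumes "\<And>i. i < n \<Longrightarrow> val_ge a r 0 (c i)"
  assumes "x ^ n + (\<Sum>i<n. c i * x ^ i) = 0"
  shows "val_ge a r 0 x"
proof (cases "x = 0")
  case False
  obtain k j where kj: "val_leading a r k j x"
    using False by (rule val_leading_exists)
  show ?thesis
  proof (cases "k \<ge> 0")
    case True
    with kj show ?thesis by (auto simp: val_leading_def intro: val_ge_mono)
  next
    case False
    have "n \<noteq> 0" using assms(2) by (rule contrapos_pn) simp
    have "val_ge a r (of_nat (n - 1) * k) (c i * x ^ i)" if "i < n" for i
    proof -
      have "val_ge a r (0 + of_nat i * k) (c i * x ^ i)"
        using kj assms(1)[OF that] by (intro val_ge_mult val_ge_power) (auto simp: val_leading_def)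
      \<comment> \<open>Multiplication by the negative \<open>k\<close> reverses the inequality
        between \<open>i\<close> and \<open>n - 1\<close>.\<close>
      moreover have "of_nat (n - 1) * k \<le> of_nat i * k"
        using that False by (intro mult_right_mono_neg) auto
      ultimately show ?thesis by (auto intro: val_ge_mono)
    qed
    then have "val_ge a r (of_nat (n - 1) * k) (- (\<Sum>i<n. c i * x ^ i))"
      by (intro val_ge_uminus val_ge_sum) auto
    also have "- (\<Sum>i<n. c i * x ^ i) = x ^ n"
      using minus_unique[of "\<Sum>i<n. c i * x ^ i" "x ^ n"] assms(2) by (simp only: add.commute)
    finally have "val_ge a r (of_nat (n - 1) * k) (x ^ n)" .
    moreover have "val_leading a r (of_nat n * k) (int n * j) (x ^ n)"
      using kj by (rule val_leading_power)
    ultimately have "of_nat (n - 1) * k \<le> of_int (ord_at a (Poly_Mapping.lookup (x ^ n) (int n * j))) + r * of_int (int n * j)"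
      "of_int (ord_at a (Poly_Mapping.lookup (x ^ n) (int n * j))) + r * of_int (int n * j) = of_nat n * k"
      unfolding val_leading_def val_ge_def by blast+
    then have "of_nat (n - 1) * k \<le> of_nat n * k"
      by simp
    with False \<open>n \<noteq> 0\<close> show ?thesis by (cases n) (auto simp: algebra_simps)
  qed
qed simp

section \<open>Integral elements\<close>

text \<open>The monic polynomial has its coefficients in the source ring of \<open>h\<close>, so
  that the image never has to be treated as a ring of its own.\<close>

definition integral_over :: "('a::comm_ring_1 \<Rightarrow> 'b::field) \<Rightarrow> 'b \<Rightarrow> bool"
  where "integral_over h x \<longleftrightarrow> (\<exists>p. Polynomial.lead_coeff p = 1 \<and> poly (map_poly h p) x = 0)"

text \<open>The homomorphism may kill leading coefficients; the sum still runs up to the degree of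
  the original polynomial, the extra terms being zero.\<close>

lemma (in comm_ring_hom) poly_map_poly_altdef:
  "poly (map_poly hom p) x = (\<Sum>i\<le>Polynomial.degree p. hom (Polynomial.coeff p i) * x ^ i)"
proof -
  have "poly (map_poly hom p) x = (\<Sum>i\<le>Polynomial.degree (map_poly hom p). hom (Polynomial.coeff p i) * x ^ i)"
    by (simp add: poly_altdef coeff_map_poly)
  also have "\<dots> = (\<Sum>i\<le>Polynomial.degree p. hom (Polynomial.coeff p i) * x ^ i)"
  proof (rule sum.mono_neutral_left)
    show "{..Polynomial.degree (map_poly hom p)} \<subseteq> {..Polynomial.degree p}"
      using degree_map_poly_le[of hom p] by simp
    show "\<forall>i\<in>{..Polynomial.degree p} - {..Polynomial.degree (map_poly hom p)}. hom (Polynomial.coeff p i) * x ^ i = 0"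
      by (metis DiffD2 atMost_iff coeff_eq_0 coeff_map_poly hom_zero linorder_not_le mult_zero_left)
  qed simp
  finally show ?thesis .
qed

locale field_algebra = comm_ring_hom h for h :: "'a::comm_ring_1 \<Rightarrow> 'b::field"
begin

sublocale M: Modules.module "\<lambda>c x. h c * x"
  by unfold_locales (simp_all add: hom_add hom_mult algebra_simps)

text \<open>The determinant trick: \<open>z\<close> is an eigenvalue of a matrix with entries in the image of \<open>h\<close>.\<close>

lemma integral_over_of_stable_span:
  assumes W: "finite W" "w\<^sub>0 \<in> W" "w\<^sub>0 \<noteq> 0"
    and stable: "\<And>w. w \<in> W \<Longrightarrow> z * w \<in> M.span W"
  shows "integral_over h z"
proof -
  define n where "n = card W"
  obtain f where f: "bij_betw f {0..<n} W"
    using W(1) ex_bij_betw_nat_finite n_def by blast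
  have "\<exists>c. z * w = (\<Sum>v\<in>W. h (c v) * v)" if "w \<in> W" for w
    using stable[OF that] M.span_finite[OF W(1)] by auto
  then obtain c where c: "\<And>w. w \<in> W \<Longrightarrow> z * w = (\<Sum>v\<in>W. h (c w v) * v)"
    by metis
  \<comment> \<open>A matrix of multiplication by \<open>z\<close> on the generators. These need not
    be independent; any choice of coefficients \<open>c\<close> will do.\<close>
  define A where "A = mat n n (\<lambda>(i, j). c (f i) (f j))"
  have A: "A \<in> carrier_mat n n" by (simp add: A_def)
  have fW: "f i \<in> W" if "i < n" for i
    using f that by (auto simp: bij_betw_def)
  \<comment> \<open>The vector of generators is itself an eigenvector for \<open>z\<close>; it is
    nonzero because of \<open>w\<^sub>0\<close>.\<close>
  have "map_mat h A *\<^sub>v vec n f = z \<cdot>\<^sub>v vec n f"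
  proof (rule eq_vecI)
    fix i assume "i < dim_vec (z \<cdot>\<^sub>v vec n f)"
    then have i: "i < n" by simp
    have "(map_mat h A *\<^sub>v vec n f) $ i = (\<Sum>j = 0..<n. h (c (f i) (f j)) * f j)"
      using i by (simp add: A_def scalar_prod_def)
    also have "\<dots> = (\<Sum>v\<in>W. h (c (f i) v) * v)"
      using sum.reindex_bij_betw[OF f, of "\<lambda>v. h (c (f i) v) * v"] by simp
    also have "\<dots> = z * f i" using c fW[OF i] by simp
    finally show "(map_mat h A *\<^sub>v vec n f) $ i = (z \<cdot>\<^sub>v vec n f) $ i"
      using i by simp
  qed (simp add: A_def)
  moreover have "vec n f \<noteq> 0\<^sub>v n"
  proof
    assume "vec n f = 0\<^sub>v n"
    then have "f i = 0" if "i < n" for i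
      using that by (metis index_vec index_zero_vec(1))
    moreover obtain i where "i < n" "f i = w\<^sub>0"
      using f W(2) by (auto simp: bij_betw_def image_iff)
    ultimately show False using W(3) by auto
  qed
  ultimately have "eigenvalue (map_mat h A) z"
    unfolding eigenvalue_def eigenvector_def by (intro exI[of _ "vec n f"]) (simp add: A_def)
  \<comment> \<open>The characteristic polynomial is formed over the source ring, where it is monic,
    and only then mapped by \<open>h\<close>.\<close>
  then have "poly (map_poly h (char_poly A)) z = 0"
    using A by (subst (asm) eigenvalue_root_char_poly[of _ n]) (auto simp: char_poly_hom[OF A])
  moreover have "Polynomial.lead_coeff (char_poly A) = 1"
    using degree_monic_char_poly[OF A] by simp
  ultimately show ?thesis unfolding integral_over_def by blast
qed

text \<open>The powers of \<open>x\<close> below the degree of the monic polynomial serve as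
  \<open>W\<close>; only the product of \<open>x\<close> with the highest of them uses the
  relation.\<close>

lemma stable_span_of_integral_over:
  assumes "integral_over h x"
  obtains W where "finite W" "1 \<in> W" "\<And>w. w \<in> W \<Longrightarrow> x * w \<in> M.span W"
proof -
  obtain p where p: "Polynomial.lead_coeff p = 1" "poly (map_poly h p) x = 0"
    using assms unfolding integral_over_def by blast
  define n where "n = Polynomial.degree p"
  have eq: "(\<Sum>i\<le>n. h (Polynomial.coeff p i) * x ^ i) = 0"
    using p(2) by (simp add: poly_map_poly_altdef n_def)
  have "n \<noteq> 0"
  proof
    assume "n = 0"
    with eq p(1) show False by (simp add: n_def)
  qed
  define W where "W = (\<lambda>i. x ^ i) ` {..<n}"
  show thesis
  proof
    show "finite W" by (simp add: W_def)
    show "1 \<in> W"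
      unfolding W_def using \<open>n \<noteq> 0\<close> by (auto intro!: image_eqI[of _ _ 0])
    fix w assume "w \<in> W"
    then obtain i where i: "w = x ^ i" "i < n" by (auto simp: W_def)
    show "x * w \<in> M.span W"
    proof (cases "Suc i < n")
      case True
      then have "x * w \<in> W"
        unfolding W_def i by (auto intro!: image_eqI[of _ _ "Suc i"])
      then show ?thesis by (rule M.span_base)
    next
      case False
      with i have n: "Suc i = n" by simp
      have "x * w = x ^ n" by (simp add: i n[symmetric])
      also have "\<dots> = - (\<Sum>i<n. h (Polynomial.coeff p i) * x ^ i)"
        using eq p(1) by (simp add: n_def[symmetric] lessThan_Suc_atMost[symmetric] add_eq_0_iff2)
      also have "\<dots> \<in> M.span W"
        by (intro M.span_neg M.span_sum M.span_scale M.span_base) (auto simp: W_def)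
      finally show ?thesis .
    qed
  qed
qed

lemma span_mult_mem:
  assumes "a \<in> M.span U" "\<And>u. u \<in> U \<Longrightarrow> u * b \<in> M.span V"
  shows "a * b \<in> M.span V"
  using assms(1)
proof (induction rule: M.span_induct_alt)
  case base
  then show ?case by (simp add: M.span_zero)
next
  case (step c x y)
  have "h c * (x * b) + y * b \<in> M.span V"
    using step assms(2) by (intro M.span_add M.span_scale) auto
  then show ?case by (simp add: algebra_simps)
qed

text \<open>The pairwise products of stable generating sets for \<open>x\<close> and
  \<open>y\<close> span a module stable under both, hence under the sum.\<close>

lemma integral_over_add:
  assumes "integral_over h x" "integral_over h y"
  shows "integral_over h (x + y)"
proof -
  obtain U where U: "finite U" "1 \<in> U" "\<And>w. w \<in> U \<Longrightarrow> x * w \<in> M.span U"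
    using stable_span_of_integral_over[OF assms(1)] by blast
  obtain V where V: "finite V" "1 \<in> V" "\<And>w. w \<in> V \<Longrightarrow> y * w \<in> M.span V"
    using stable_span_of_integral_over[OF assms(2)] by blast
  define W where "W = (\<lambda>(a, b). a * b) ` (U \<times> V)"
  have W: "a * b \<in> M.span W" if "a \<in> U" "b \<in> V" for a b
    using that by (intro M.span_base) (auto simp: W_def)
  show ?thesis
  proof (rule integral_over_of_stable_span)
    show "finite W" using U V by (simp add: W_def)
    show "1 \<in> W" unfolding W_def using U V by (auto intro!: image_eqI[of _ _ "(1, 1)"])
    fix w assume "w \<in> W"
    then obtain a b where ab: "a \<in> U" "b \<in> V" "w = a * b" by (auto simp: W_def)
    have "x * a * b \<in> M.span W"
      by (rule span_mult_mem[OF U(3)[OF ab(1)]]) (rule W[OF _ ab(2)])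
    moreover have "y * b * a \<in> M.span W"
      by (rule span_mult_mem[OF V(3)[OF ab(2)]]) (use W[OF ab(1)] in \<open>simp add: mult.commute\<close>)
    ultimately show "(x + y) * w \<in> M.span W"
      using M.span_add by (simp add: ab algebra_simps)
  qed simp
qed

lemma integral_over_hom: "integral_over h (h c)"
  unfolding integral_over_def
  by (rule exI[of _ "[:- c, 1:]"]) (simp add: hom_distribs)

lemma integral_over_0: "integral_over h 0"
  using integral_over_hom[of 0] by simp

lemma integral_over_sum:
  "(\<And>i. i \<in> S \<Longrightarrow> integral_over h (f i)) \<Longrightarrow> integral_over h (sum f S)"
  by (induction S rule: infinite_finite_induct) (auto intro: integral_over_add integral_over_0)

text \<open>The polynomial \<open>X^k - c\<close> is monic with root \<open>x\<close>. This serves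
  the homogeneous elements of negative degree.\<close>

lemma integral_over_of_power:
  assumes "x ^ k = h c" "k \<noteq> 0"
  shows "integral_over h x"
proof -
  let ?p = "Polynomial.monom 1 k - [:c:]"
  from assms(2) have 1: "Polynomial.coeff ?p k = 1"
    by (cases k) auto
  then have "k \<le> Polynomial.degree ?p"
    by (intro le_degree) simp
  moreover have "Polynomial.degree ?p \<le> k"
    by (intro degree_diff_le) (auto simp: degree_monom_le)
  ultimately have "Polynomial.degree ?p = k"
    by simp
  moreover have "map_poly h ?p = Polynomial.monom 1 k - [:h c:]"
    by (rule poly_eqI) (auto simp: coeff_map_poly hom_minus coeff_pCons split: nat.split)
  then have "poly (map_poly h ?p) x = 0"
    by (simp add: assms poly_monom)
  ultimately show ?thesis using 1 unfolding integral_over_def by (intro exI[of _ ?p]) simp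
qed

end

text \<open>The rational root argument: each term of the sum contains a factor \<open>q\<close>, so
  \<open>q\<close> divides \<open>e * p^n\<close> and is coprime to \<open>p^n\<close>.\<close>

lemma dvd_of_coprime_homogeneous_relation:
  fixes p q e :: "'a::{semiring_gcd, comm_ring_1}"
  assumes "coprime p q" "e * p ^ n + (\<Sum>i<n. c i * p ^ i * q ^ (n - i)) = 0"
  shows "q dvd e"
proof -
  have "q dvd (\<Sum>i<n. c i * p ^ i * q ^ (n - i))"
    by (intro dvd_sum dvd_mult dvd_power) auto
  with assms(2) have "q dvd e * p ^ n"
    by (metis dvd_add_left_iff dvd_0_right)
  moreover have "coprime q (p ^ n)"
    using assms(1) by (simp add: coprime_commute)
  ultimately show ?thesis by (simp add: coprime_dvd_mult_left_iff)
qed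

section \<open>The embedding into Laurent polynomials\<close>

lemma comm_ring_hom_poly_map_poly:
  assumes "comm_ring_hom f"
  shows "comm_ring_hom (\<lambda>p. poly (map_poly f p) x)"
proof -
  interpret f: comm_ring_hom f by fact
  interpret mp: map_poly_comm_ring_hom f ..
  show ?thesis by unfold_locales (simp_all add: mp.hom_add mp.hom_mult)
qed

lemma poly_map_poly_pCons:
  assumes "comm_ring_hom f"
  shows "poly (map_poly f (pCons a p)) x = f a + x * poly (map_poly f p) x"
proof -
  interpret f: comm_ring_hom f by fact
  show ?thesis by (simp add: f.map_poly_pCons_hom)
qed

lemma laurent_eq_sum_single:
  "(y :: laurent) = (\<Sum>n\<in>Poly_Mapping.keys y. Poly_Mapping.single n (Poly_Mapping.lookup y n))"
  by (rule poly_mapping_eqI) (auto simp: lookup_sum lookup_single when_def in_keys_iff)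

lemma val_ge_poly:
  assumes "comm_ring_hom f" "\<And>c. val_ge a r 0 (f c)" "val_ge a r 0 x"
  shows "val_ge a r 0 (poly (map_poly f p) x)"
proof (induction p)
  case (pCons c p)
  then show ?case
    using val_ge_mult[OF assms(3), of 0] assms(2)
    by (simp add: poly_map_poly_pCons[OF assms(1)] val_ge_add)
qed simp

lemma to_fract_power: "to_fract (x ^ n) = to_fract x ^ n"
  by (induction n) simp_all

lemma prime_elem_poly_X: "prime_elem [:0, 1 :: 'a::idom:]"
proof (rule prime_elemI)
  show "\<not> [:0, 1 :: 'a:] dvd 1"
    using poly_eq_0_iff_dvd[of 1 "0 :: 'a"] by simp
  show "[:0, 1:] dvd p \<or> [:0, 1:] dvd q" if "[:0, 1 :: 'a:] dvd p * q" for p q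
    using that poly_eq_0_iff_dvd[of p "0 :: 'a"] poly_eq_0_iff_dvd[of q "0 :: 'a"]
      poly_eq_0_iff_dvd[of "p * q" "0 :: 'a"] by simp
qed simp

text \<open>One factor \<open>p\<close> is cancelled at a time: as \<open>p\<close> does not divide
  \<open>g\<close>, it divides the cofactor.\<close>

lemma dvd_of_dvd_prime_elem_power_mult:
  fixes p g f :: "'a::idom"
  assumes "prime_elem p" "\<not> p dvd g" "g dvd p ^ m * f"
  shows "g dvd f"
  using assms(3)
proof (induction m)
  case (Suc m)
  then obtain q where q: "p * (p ^ m * f) = g * q"
    by (auto simp: mult.assoc elim!: dvdE)
  then have "p dvd g * q" by (metis dvd_triv_left)
  with assms(1,2) have "p dvd q" by (metis prime_elem_dvd_multD)
  then obtain q' where "q = p * q'" ..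
  with q have "p * (p ^ m * f) = p * (g * q')"
    by (simp add: mult.left_commute)
  with assms(1) have "p ^ m * f = g * q'"
    by (metis mult_left_cancel prime_elem_def)
  then show ?case by (intro Suc.IH) simp
qed simp

section \<open>Divisor conditions as valuation inequalities\<close>

text \<open>Rounding down disappears because orders are integers. For negative \<open>n\<close> the
  divisor \<open>(- n) * Dm\<close> is written as \<open>(- Dm) * n\<close>, so both cases have the
  shape of a Gauss valuation.\<close>

lemma mem_dpd_coeffs:
  "f \<in> dpd_coeffs Dp Dm n \<longleftrightarrow> f = 0 \<or> (\<forall>a. 0 \<le> of_int (ord_at a f) +
     (if 0 \<le> n then Poly_Mapping.lookup Dp a else - Poly_Mapping.lookup Dm a) * of_int n)"
proof -
  have *: "0 \<le> (of_int k + of_int \<lfloor>q\<rfloor> :: rat) \<longleftrightarrow> 0 \<le> of_int k + q" for k :: int and q :: rat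
    using le_floor_iff[of "- k" q] by (simp flip: of_int_add) linarith
  show ?thesis
    by (cases "f = 0") (auto simp: dpd_coeffs_def H0_def qdiv_le_def lookup_add lookup_principal_qdiv
        lookup_qdiv_floor lookup_qdiv_scale * mult.commute)
qed

text \<open>Since \<open>Dp\<close> is at most \<open>- Dm\<close>, the condition with
  \<open>Dp\<close> is the stronger one in degrees \<open>n >= 0\<close> and the one with
  \<open>- Dm\<close> in degrees \<open>n <= 0\<close>. Hence both may be imposed in every
  degree.\<close>

lemma mem_carrier_dpd_algebra:
  assumes "qdiv_le (Dp + Dm) 0"
  shows "x \<in> carrier (dpd_algebra Dp Dm) \<longleftrightarrow>
    (\<forall>a. val_ge a (Poly_Mapping.lookup Dp a) 0 x \<and> val_ge a (- Poly_Mapping.lookup Dm a) 0 x)"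
proof -
  have le: "Poly_Mapping.lookup Dp a \<le> - Poly_Mapping.lookup Dm a" for a
    using assms by (auto simp: qdiv_le_def lookup_add algebra_simps dest!: spec[of _ a])
  have "(0 \<le> k + (if 0 \<le> n then Poly_Mapping.lookup Dp a else - Poly_Mapping.lookup Dm a) * of_int n) \<longleftrightarrow>
    0 \<le> k + Poly_Mapping.lookup Dp a * of_int n \<and> 0 \<le> k + - Poly_Mapping.lookup Dm a * of_int n"
    for k a and n :: int
  proof (cases "0 \<le> n")
    case True
    then show ?thesis using mult_right_mono[OF le[of a], of "of_int n"] by auto
  next
    case False
    then show ?thesis using mult_right_mono_neg[OF le[of a], of "of_int n"] by auto
  qed
  then show ?thesis
    unfolding val_ge_def by (simp add: dpd_algebra_def mem_dpd_coeffs del: minus_mult_left) blast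
qed

text \<open>The normal form of a pair with integral \<open>Dp\<close>: \<open>Dp = - div g\<close>
  and \<open>Dm = div g - div P / d\<close>, so that the sum is \<open>- div P / d\<close>.\<close>

locale dpd_embedding =
  fixes g :: "complex poly fract" and P :: "complex poly" and d :: nat and Dp Dm :: qdivisor
  assumes g: "g \<noteq> 0" and P: "P \<noteq> 0" and d: "d \<noteq> 0"
    and Dp: "\<And>a. Poly_Mapping.lookup Dp a = - of_int (ord_at a g)"
    and Dm: "\<And>a. Poly_Mapping.lookup Dm a = of_int (ord_at a g) - of_nat (Polynomial.order a P) / of_nat d"
begin

lemma Dp_Dm_le: "qdiv_le (Dp + Dm) 0"
  by (simp add: qdiv_le_def lookup_add Dp Dm)

section \<open>The homomorphism from \<open>C[t,u,v]\<close> and its kernel\<close>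

definition cst :: "complex poly \<Rightarrow> laurent"
  where "cst p = Poly_Mapping.single 0 (to_fract p)"

definition iota :: "complex poly poly \<Rightarrow> laurent"
  where "iota s = poly (map_poly cst s) (Poly_Mapping.single 1 g)"

definition ev :: "complex poly poly poly \<Rightarrow> laurent"
  where "ev f = poly (map_poly iota f) (Poly_Mapping.single (- int d) (to_fract P / g ^ d))"

sublocale cst: comm_ring_hom cst
  by unfold_locales (simp_all add: cst_def single_add mult_single)

sublocale iota: comm_ring_hom iota
  unfolding iota_def by (rule comm_ring_hom_poly_map_poly) (rule cst.comm_ring_hom_axioms)

sublocale ev: comm_ring_hom ev
  unfolding ev_def by (rule comm_ring_hom_poly_map_poly) (rule iota.comm_ring_hom_axioms)

lemma iota_pCons: "iota (pCons p s) = cst p + Poly_Mapping.single 1 g * iota s"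
  unfolding iota_def by (rule poly_map_poly_pCons) (rule cst.comm_ring_hom_axioms)

lemma ev_pCons:
  "ev (pCons s f) = iota s + Poly_Mapping.single (- int d) (to_fract P / g ^ d) * ev f"
  unfolding ev_def by (rule poly_map_poly_pCons) (rule iota.comm_ring_hom_axioms)

lemma ev_const: "ev [:s:] = iota s"
  by (simp add: ev_pCons)

lemma lookup_iota:
  "Poly_Mapping.lookup (iota s) n =
    (if 0 \<le> n then to_fract (Polynomial.coeff s (nat n)) * g ^ nat n else 0)"
proof (induction s arbitrary: n)
  case (pCons p s)
  have n: "n < 0 \<or> n = 0 \<or> (\<exists>m. n = 1 + int m)"
    by presburger
  show ?case
    using n by (elim disjE exE) (auto simp: iota_pCons lookup_add lookup_single_times pCons.IH cst_def
        lookup_single nat_add_distrib)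
qed simp

lemma iota_eq_0_iff: "iota s = 0 \<longleftrightarrow> s = 0"
proof
  assume "iota s = 0"
  then have "Polynomial.coeff s i = 0" for i
    using lookup_iota[of s "int i"] g by simp
  then show "s = 0" by (simp add: poly_eq_iff)
qed simp

lemma iota_monom: "iota (Polynomial.monom p n) = Poly_Mapping.single (int n) (to_fract p * g ^ n)"
  by (rule poly_mapping_eqI) (auto simp: lookup_iota lookup_single when_def)

lemma iota_X: "iota [:0, 1:] = Poly_Mapping.single 1 g"
  by (simp add: iota_pCons cst_def)

lemma ev_const_tuv: "ev (const_tuv p) = cst p"
  by (simp add: const_tuv_def ev_const iota_pCons)

lemma ev_v: "ev v_tuv = Poly_Mapping.single (- int d) (to_fract P / g ^ d)"
  by (simp add: v_tuv_def ev_pCons)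

lemma ev_relation: "ev (u_tuv ^ d * v_tuv - const_tuv P) = 0"
proof -
  have "ev u_tuv = Poly_Mapping.single 1 g"
    unfolding u_tuv_def ev_const iota_X ..
  then show ?thesis
    using g by (simp add: ev.hom_minus ev.hom_mult ev.hom_power ev_v ev_const_tuv cst_def single_power mult_single)
qed

text \<open>As a polynomial in \<open>v\<close> the relation is linear with leading coefficient
  \<open>u^d\<close>, the form that pseudo-division needs.\<close>

lemma relation_eq: "u_tuv ^ d * v_tuv - const_tuv P = [:- [:P:], [:0, 1:] ^ d:]"
proof -
  have "u_tuv ^ d = [:[:0, 1:] ^ d:]"
    unfolding u_tuv_def by (simp add: poly_const_pow)
  then show ?thesis by (simp add: v_tuv_def const_tuv_def)
qed

text \<open>
  Pseudo-division by \<open>u\<^sup>d v - P\<close> in \<open>v\<close> shows that it divides \<open>u\<^sup>m f\<close>; then \<open>u\<close> is cancelled,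
  being prime and not a divisor of \<open>u\<^sup>d v - P\<close>.
\<close>

lemma ev_eq_0_iff: "ev f = 0 \<longleftrightarrow> u_tuv ^ d * v_tuv - const_tuv P dvd f"
proof
  let ?G = "u_tuv ^ d * v_tuv - const_tuv P"
  assume "ev f = 0"
  have lc: "Polynomial.coeff ?G (Polynomial.degree ?G) = [:0, 1:] ^ d" and deg: "Polynomial.degree ?G = 1"
    unfolding relation_eq by simp_all
  then have "?G \<noteq> 0" by auto
  obtain q r where qr: "pseudo_divmod f ?G = (q, r)"
    by (cases "pseudo_divmod f ?G")
  obtain k where k: "Polynomial.smult (([:0, 1:] ^ d) ^ k) f = ?G * q + r"
    using pseudo_divmod(1)[OF \<open>?G \<noteq> 0\<close> qr] unfolding lc by blast
  have "r = 0 \<or> Polynomial.degree r < 1"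
    using pseudo_divmod(2)[OF \<open>?G \<noteq> 0\<close> qr] unfolding deg .
  then have "\<exists>r\<^sub>0. r = [:r\<^sub>0:]"
    by (metis degree_eq_zeroE less_one pCons_0_0)
  then obtain r\<^sub>0 where r: "r = [:r\<^sub>0:]" ..
  have k': "[:[:0, 1:]:] ^ (d * k) * f = ?G * q + r"
    using k by (simp add: poly_const_pow power_mult)
  \<comment> \<open>The remainder is constant in \<open>v\<close>. There \<open>ev\<close> agrees
    with the injective \<open>iota\<close>, so the remainder vanishes because its image
    does.\<close>
  have "iota r\<^sub>0 = ev r" by (simp add: r ev_const)
  also have "\<dots> = ev ([:[:0, 1:]:] ^ (d * k) * f - ?G * q)"
    unfolding k' by simp
  also have "\<dots> = 0"
    using ev.hom_mult[of ?G q] unfolding ev_relation ev.hom_minus[of _ "?G * q"] ev.hom_mult[of _ f] \<open>ev f = 0\<close> by simp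
  finally have "r = 0" by (simp add: r iota_eq_0_iff)
  with k' have "?G dvd [:[:0, 1:]:] ^ (d * k) * f" by simp
  moreover have "prime_elem [:[:0, 1 :: complex poly:]:]"
    by (rule lift_prime_elem_poly) (rule prime_elem_poly_X)
  \<comment> \<open>The coefficient of \<open>v^0\<close> is \<open>- P\<close>, which does not
    vanish at \<open>u = 0\<close>.\<close>
  moreover have "\<not> [:[:0, 1:]:] dvd ?G"
  proof
    assume "[:[:0, 1:]:] dvd ?G"
    then have "[:0, 1:] dvd Polynomial.coeff ?G 0"
      by (simp only: const_poly_dvd_iff)
    then have "[:0, 1:] dvd - [:P:]"
      unfolding relation_eq by simp
    with P show False
      using poly_eq_0_iff_dvd[of "- [:P:]" 0] by simp
  qed
  ultimately show "?G dvd f" by (metis dvd_of_dvd_prime_elem_power_mult)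
next
  assume "u_tuv ^ d * v_tuv - const_tuv P dvd f"
  then obtain q where "f = (u_tuv ^ d * v_tuv - const_tuv P) * q" ..
  then have "ev f = ev (u_tuv ^ d * v_tuv - const_tuv P) * ev q"
    by (simp only: ev.hom_mult)
  then show "ev f = 0"
    unfolding ev_relation by simp
qed

text \<open>It suffices to check generators. At \<open>a\<close> the images of \<open>u\<close> and
  \<open>v\<close> have values \<open>0\<close> and \<open>ord P\<close> for the weight
  \<open>Dp\<close>, and \<open>ord P / d\<close> and \<open>0\<close> for the weight
  \<open>- Dm\<close>.\<close>

lemma val_ge_ev:
  assumes "r = Poly_Mapping.lookup Dp a \<or> r = - Poly_Mapping.lookup Dm a"
  shows "val_ge a r 0 (ev f)"
  unfolding ev_def
proof (rule val_ge_poly)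
  have "val_ge a r 0 (cst p)" for p
    by (cases "p = 0") (simp_all add: cst_def val_ge_single ord_at_to_fract)
  moreover have "val_ge a r 0 (Poly_Mapping.single 1 g)"
    using assms g d by (auto simp: val_ge_single Dp Dm)
  ultimately show "val_ge a r 0 (iota c)" for c
    unfolding iota_def by (intro val_ge_poly cst.comm_ring_hom_axioms)
  show "val_ge a r 0 (Poly_Mapping.single (- int d) (to_fract P / g ^ d))"
    using assms g d P by (auto simp: val_ge_single Dp Dm ord_at_divide ord_at_to_fract ord_at_power field_simps)
qed (rule iota.comm_ring_hom_axioms)

text \<open>Each factor \<open>v\<close> is absorbed by \<open>u^d\<close>, as
  \<open>u^d v = P\<close>. The claim covers all large \<open>N\<close>, so that finitely many
  elements admit a common exponent.\<close>

lemma ev_clear_u: "\<exists>M. \<forall>N\<ge>M. \<exists>s. iota ([:0, 1:] ^ N) * ev f = iota s"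
proof (induction f)
  case 0
  then show ?case by (auto intro: exI[of _ 0])
next
  case (pCons c f)
  then obtain M where M: "\<And>N. N \<ge> M \<Longrightarrow> \<exists>s. iota ([:0, 1:] ^ N) * ev f = iota s"
    by blast
  have w: "iota ([:0, 1:] ^ d) * Poly_Mapping.single (- int d) (to_fract P / g ^ d) = iota [:P:]"
    unfolding iota.hom_power iota_X using g by (simp add: single_power mult_single iota_pCons cst_def)
  have "\<exists>s. iota ([:0, 1:] ^ N) * ev (pCons c f) = iota s" if "N \<ge> M + d" for N
  proof -
    have "M \<le> N - d" using that by simp
    from M[OF this] obtain s where s: "iota ([:0, 1:] ^ (N - d)) * ev f = iota s" ..
    have N: "iota ([:0, 1:] ^ N) = iota ([:0, 1:] ^ (N - d)) * iota ([:0, 1:] ^ d)"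
      using that by (simp only: iota.hom_mult[symmetric] power_add[symmetric]) simp
    have "iota ([:0, 1:] ^ N) * ev (pCons c f) =
        iota ([:0, 1:] ^ N) * iota c +
        (iota ([:0, 1:] ^ d) * Poly_Mapping.single (- int d) (to_fract P / g ^ d)) *
          (iota ([:0, 1:] ^ (N - d)) * ev f)"
      unfolding ev_pCons by (simp only: N algebra_simps)
    also have "\<dots> = iota ([:0, 1:] ^ N * c + [:P:] * s)"
      unfolding w s iota.hom_add iota.hom_mult ..
    finally show ?thesis by blast
  qed
  then show ?case by blast
qed

section \<open>Fractions, and integral elements as Laurent polynomials\<close>

text \<open>With \<open>f g^(-n) = p / q\<close>, the monomial \<open>f u^n\<close> is the quotient
  of \<open>p (g u)^i\<close> by \<open>q (g u)^j\<close>, where \<open>j\<close> or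
  \<open>i\<close> is zero according to the sign of \<open>n\<close>.\<close>

lemma single_homogeneous_quotient:
  obtains p q i j where "q \<noteq> 0" "n = int i - int j"
    "Poly_Mapping.single n f * iota (Polynomial.monom q j) = iota (Polynomial.monom p i)"
proof -
  obtain p q where pq: "q \<noteq> 0" "f * g powi (- n) = Fraction_Field.Fract p q"
    by (cases "f * g powi (- n)") auto
  then have f: "f * to_fract q = to_fract p * g powi n"
    using g by (simp add: Fract_conv_to_fract power_int_minus field_simps)
  show thesis
  proof (cases "0 \<le> n")
    case True
    show thesis
    proof
      show "Poly_Mapping.single n f * iota (Polynomial.monom q 0) = iota (Polynomial.monom p (nat n))"
        unfolding iota_monom using f True by (simp add: mult_single power_int_def)
    qed (use pq True in auto)
  next
    case False
    have f': "f * (to_fract q * g ^ nat (- n)) = to_fract p"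
      using f g False by (simp add: power_int_def field_simps)
    show thesis
    proof
      show "Poly_Mapping.single n f * iota (Polynomial.monom q (nat (- n))) = iota (Polynomial.monom p 0)"
        unfolding iota_monom using f' False by (simp add: mult_single)
    qed (use pq False in auto)
  qed
qed

lemma laurent_clear_denominator: "\<exists>e s. e \<noteq> 0 \<and> y * iota e = iota s"
proof -
  have "\<exists>e s. e \<noteq> 0 \<and> (\<Sum>n\<in>S. Poly_Mapping.single n (Poly_Mapping.lookup y n)) * iota e = iota s"
    if "finite S" for S
    using that
  proof (induction S)
    case empty
    show ?case by (intro exI[of _ 1] exI[of _ 0]) simp
  next
    case (insert n S)
    then obtain e s where e: "e \<noteq> 0"
      "(\<Sum>n\<in>S. Poly_Mapping.single n (Poly_Mapping.lookup y n)) * iota e = iota s"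
      by blast
    obtain e' s' where e': "e' \<noteq> 0" "Poly_Mapping.single n (Poly_Mapping.lookup y n) * iota e' = iota s'"
      by (metis single_homogeneous_quotient monom_eq_0_iff)
    have "(\<Sum>n\<in>insert n S. Poly_Mapping.single n (Poly_Mapping.lookup y n)) * iota (e * e') =
      (Poly_Mapping.single n (Poly_Mapping.lookup y n) * iota e') * iota e +
      ((\<Sum>n\<in>S. Poly_Mapping.single n (Poly_Mapping.lookup y n)) * iota e) * iota e'"
      using insert.hyps by (simp add: iota.hom_mult algebra_simps)
    also have "\<dots> = iota (s' * e + s * e')"
      unfolding e e' by (simp add: iota.hom_add iota.hom_mult)
    finally show ?case using e(1) e'(1) by (metis mult_eq_0_iff)
  qed
  from this[of "Poly_Mapping.keys y"] show ?thesis
    by (simp flip: laurent_eq_sum_single)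
qed

text \<open>Denominators are cleared in numerator and denominator separately. The resulting quotient
  comes from \<open>C[t][u]\<close>, where common factors can be removed by the gcd.\<close>

lemma fract_laurent_eq_coprime_quotient:
  obtains p q where "coprime p q" "q \<noteq> 0" "x = to_fract (iota p) / to_fract (iota q)"
proof -
  obtain y z where yz: "x = to_fract y / to_fract z" "z \<noteq> 0"
    by (cases x) (auto simp: Fract_conv_to_fract)
  obtain e s where e: "e \<noteq> 0" "y * iota e = iota s"
    using laurent_clear_denominator by blast
  obtain e' s' where e': "e' \<noteq> 0" "z * iota e' = iota s'"
    using laurent_clear_denominator by blast
  let ?p = "s * e'" and ?q = "s' * e"
  have nz: "?q \<noteq> 0" using e e' yz iota_eq_0_iff[of s'] iota_eq_0_iff[of e'] by auto
  have "y * iota ?q = z * iota ?p"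
    unfolding iota.hom_mult e(2)[symmetric] e'(2)[symmetric] by (simp add: mult_ac)
  then have "to_fract y * to_fract (iota ?q) = to_fract z * to_fract (iota ?p)"
    unfolding to_fract_mult[symmetric] by simp
  then have x: "x * to_fract (iota ?q) = to_fract (iota ?p)"
    using yz(2) unfolding yz(1) by (simp add: field_simps)
  obtain p q r where pq: "?p = p * r" "?q = q * r" "coprime p q"
    using gcd_coprime_exists[of ?p ?q] nz by auto
  have "q \<noteq> 0" "r \<noteq> 0" using nz pq(2) by auto
  moreover have "x * (to_fract (iota q) * to_fract (iota r)) = to_fract (iota p) * to_fract (iota r)"
    using x unfolding pq(1,2) iota.hom_mult to_fract_mult .
  ultimately have "x = to_fract (iota p) / to_fract (iota q)"
    by (simp add: iota_eq_0_iff eq_divide_eq mult.assoc[symmetric])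
  with \<open>q \<noteq> 0\<close> pq(3) that show thesis by blast
qed

sublocale evK: field_algebra "\<lambda>f. to_fract (ev f)"
  by unfold_locales (simp_all add: ev.hom_add ev.hom_mult)

lemma integral_over_imp_laurent:
  assumes "integral_over (\<lambda>f. to_fract (ev f)) x"
  obtains y where "x = to_fract y"
proof -
  obtain F where F: "Polynomial.lead_coeff F = 1" "poly (map_poly (\<lambda>f. to_fract (ev f)) F) x = 0"
    using assms unfolding integral_over_def by blast
  obtain p q where pq: "coprime p q" "q \<noteq> 0" "x = to_fract (iota p) / to_fract (iota q)"
    by (rule fract_laurent_eq_coprime_quotient)
  define n where "n = Polynomial.degree F"
  let ?c = "Polynomial.coeff F"
  have "poly (map_poly (\<lambda>f. to_fract (ev f)) F) x = (\<Sum>i\<le>n. to_fract (ev (?c i)) * x ^ i)"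
    by (simp add: evK.poly_map_poly_altdef n_def)
  \<comment> \<open>Multiplication by \<open>q^n\<close> removes the denominators of all powers of
    \<open>x\<close>.\<close>
  with F(2) have "0 = to_fract (iota q) ^ n * (\<Sum>i\<le>n. to_fract (ev (?c i)) * x ^ i)"
    by simp
  also have "\<dots> = (\<Sum>i\<le>n. to_fract (ev (?c i)) * to_fract (iota p) ^ i * to_fract (iota q) ^ (n - i))"
    unfolding sum_distrib_left
  proof (rule sum.cong)
    fix i assume "i \<in> {..n}"
    then have "to_fract (iota q) ^ n = to_fract (iota q) ^ i * to_fract (iota q) ^ (n - i)"
      by (simp flip: power_add)
    then show "to_fract (iota q) ^ n * (to_fract (ev (?c i)) * x ^ i) =
        to_fract (ev (?c i)) * to_fract (iota p) ^ i * to_fract (iota q) ^ (n - i)"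
      using pq by (simp add: iota_eq_0_iff power_divide)
  qed simp
  also have "\<dots> = to_fract (\<Sum>i\<le>n. ev (?c i) * iota (p ^ i * q ^ (n - i)))"
    by (simp add: iota.hom_mult iota.hom_power to_fract_power mult.assoc)
  finally have rel: "(\<Sum>i\<le>n. ev (?c i) * iota (p ^ i * q ^ (n - i))) = 0"
    by (subst (asm) eq_commute) (simp only: to_fract_eq_0_iff)
  obtain M where M: "\<And>f N. N \<ge> M f \<Longrightarrow> \<exists>s. iota ([:0, 1:] ^ N) * ev f = iota s"
    using ev_clear_u by metis
  \<comment> \<open>The sum dominates every single bound, so one power of \<open>u\<close> brings
    all coefficients into \<open>C[t][u]\<close>.\<close>
  define N where "N = (\<Sum>i\<le>n. M (?c i))"
  have "\<exists>s. iota ([:0, 1:] ^ N) * ev (?c i) = iota s" if "i \<le> n" for i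
    using that by (intro M) (auto simp: N_def intro: member_le_sum)
  then obtain s where s: "\<And>i. i \<le> n \<Longrightarrow> iota ([:0, 1:] ^ N) * ev (?c i) = iota (s i)"
    by metis
  have "iota (\<Sum>i\<le>n. s i * (p ^ i * q ^ (n - i))) =
      (\<Sum>i\<le>n. iota ([:0, 1:] ^ N) * ev (?c i) * iota (p ^ i * q ^ (n - i)))"
    unfolding iota.hom_sum by (rule sum.cong) (simp_all add: s iota.hom_mult)
  also have "\<dots> = 0"
    using rel by (simp add: mult.assoc flip: sum_distrib_left)
  finally have "(\<Sum>i\<le>n. s i * (p ^ i * q ^ (n - i))) = 0"
    by (simp add: iota_eq_0_iff)
  \<comment> \<open>The monic leading coefficient becomes \<open>u^N\<close>; this is what
    \<open>q\<close> is going to divide.\<close>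
  moreover have "s n = [:0, 1:] ^ N"
  proof -
    have "iota (s n - [:0, 1:] ^ N) = 0"
      using s[of n] F(1) by (simp add: n_def iota.hom_minus)
    then show ?thesis by (simp add: iota_eq_0_iff)
  qed
  ultimately have "[:0, 1:] ^ N * p ^ n + (\<Sum>i<n. s i * p ^ i * q ^ (n - i)) = 0"
    by (simp add: lessThan_Suc_atMost[symmetric] mult.assoc add.commute)
  then have "q dvd [:0, 1:] ^ N"
    by (rule dvd_of_coprime_homogeneous_relation[OF pq(1)])
  then obtain r where r: "[:0, 1:] ^ N = q * r" ..
  \<comment> \<open>The inverse of the image of \<open>u^N\<close>. The image of its divisor
    \<open>q\<close> is therefore a unit among Laurent polynomials.\<close>
  let ?v = "Poly_Mapping.single (- int N) (inverse (g ^ N))"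
  have "iota q * iota r * ?v = 1"
    unfolding iota.hom_mult[symmetric] r[symmetric] iota.hom_power iota_X
    using g by (simp add: single_power mult_single)
  then have "to_fract (iota q) * to_fract (iota r * ?v) = 1"
    unfolding to_fract_mult[symmetric] by (simp add: mult.assoc)
  then have "x = to_fract (iota p) * to_fract (iota r * ?v)"
    unfolding pq(3) by (simp add: divide_inverse inverse_unique)
  then show thesis using that by (metis to_fract_mult)
qed

text \<open>The relation descends from the fraction field to Laurent polynomials, and its
  coefficients lie in all the valuation rings by \<open>val_ge_ev\<close>; these rings are
  integrally closed.\<close>

lemma integral_over_imp_mem:
  assumes "integral_over (\<lambda>f. to_fract (ev f)) (to_fract y)"
  shows "y \<in> carrier (dpd_algebra Dp Dm)"
proof -
  obtain F where F: "Polynomial.lead_coeff F = 1" "poly (map_poly (\<lambda>f. to_fract (ev f)) F) (to_fract y) = 0"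
    using assms unfolding integral_over_def by blast
  define n where "n = Polynomial.degree F"
  let ?c = "Polynomial.coeff F"
  have "poly (map_poly (\<lambda>f. to_fract (ev f)) F) (to_fract y) = to_fract (\<Sum>i\<le>n. ev (?c i) * y ^ i)"
    by (simp add: evK.poly_map_poly_altdef n_def to_fract_power)
  with F(2) have "(\<Sum>i\<le>n. ev (?c i) * y ^ i) = 0"
    by (simp only: to_fract_eq_0_iff)
  with F(1) have "y ^ n + (\<Sum>i<n. ev (?c i) * y ^ i) = 0"
    by (simp add: lessThan_Suc_atMost[symmetric] n_def add.commute)
  then show ?thesis
    unfolding mem_carrier_dpd_algebra[OF Dp_Dm_le]
    by (intro allI conjI; elim val_ge_of_monic_relation[rotated]) (auto intro: val_ge_ev)
qed

section \<open>Homogeneous elements are integral\<close>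

text \<open>As \<open>Dp\<close> is minus the divisor of \<open>g\<close>, division by
  \<open>g^n\<close> leaves a function without poles.\<close>

lemma dpd_coeffs_nonneg:
  assumes "0 \<le> n"
  shows "dpd_coeffs Dp Dm n = {to_fract p * g ^ nat n | p. True}"
proof (intro equalityI subsetI)
  fix f assume f: "f \<in> dpd_coeffs Dp Dm n"
  have "f / g ^ nat n = 0 \<or> 0 \<le> ord_at a (f / g ^ nat n)" for a
  proof (cases "f = 0")
    case False
    have "0 \<le> (of_int (ord_at a f - ord_at a g * n) :: rat)"
      using assms f False by (auto simp: mem_dpd_coeffs Dp)
    then have "0 \<le> ord_at a f - ord_at a g * n"
      unfolding of_int_0_le_iff .
    with assms g False show ?thesis by (simp add: ord_at_divide ord_at_power mult.commute)
  qed simp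
  then obtain p where "f / g ^ nat n = to_fract p"
    using eq_to_fract_of_ord_at_nonneg by blast
  then have "f = to_fract p * g ^ nat n"
    using g by (simp add: field_simps)
  then show "f \<in> {to_fract p * g ^ nat n | p. True}" by blast
next
  fix f assume "f \<in> {to_fract p * g ^ nat n | p. True}"
  then obtain p where f: "f = to_fract p * g ^ nat n" by blast
  show "f \<in> dpd_coeffs Dp Dm n"
    using assms g unfolding mem_dpd_coeffs
    by (cases "p = 0") (auto simp: f Dp ord_at_mult ord_at_power ord_at_to_fract algebra_simps)
qed

lemma integral_over_single:
  assumes "f \<in> dpd_coeffs Dp Dm n"
  shows "integral_over (\<lambda>f. to_fract (ev f)) (to_fract (Poly_Mapping.single n f))"
proof (cases "f = 0")
  case True
  then show ?thesis by (simp add: evK.integral_over_0)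
next
  case False
  show ?thesis
  proof (cases "0 \<le> n")
    case True
    then obtain p where "f = to_fract p * g ^ nat n"
      using assms dpd_coeffs_nonneg by auto
    then have "Poly_Mapping.single n f = ev [:Polynomial.monom p (nat n):]"
      using True by (simp add: ev_const iota_monom)
    then show ?thesis by (simp add: evK.integral_over_hom)
  next
    case neg: False
    define m where "m = nat (- n)"
    have n: "n = - int m" using neg by (simp add: m_def)
    \<comment> \<open>The quotient of \<open>(f u^(-m))^d\<close> by the \<open>m\<close>-th power
      of the image of \<open>v\<close>; it turns out to be a polynomial.\<close>
    let ?F = "f ^ d * (g ^ d) ^ m / to_fract P ^ m"
    have "0 \<le> ord_at a ?F" for a
    proof -
      have "0 \<le> of_int (ord_at a f) - of_nat m * (of_nat (Polynomial.order a P) / of_nat d - (of_int (ord_at a g) :: rat))"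
        using assms False neg by (auto simp: mem_dpd_coeffs Dm n algebra_simps)
      \<comment> \<open>The factor \<open>d\<close> turns the rational estimate into one between
        integers.\<close>
      then have "0 \<le> of_nat d * (of_int (ord_at a f) - of_nat m * (of_nat (Polynomial.order a P) / of_nat d - (of_int (ord_at a g) :: rat)))"
        by (rule mult_nonneg_nonneg[OF of_nat_0_le_iff])
      also have "\<dots> = of_int (int d * ord_at a f - int m * (int (Polynomial.order a P) - int d * ord_at a g))"
        using d by (simp add: algebra_simps)
      finally have "0 \<le> int d * ord_at a f - int m * (int (Polynomial.order a P) - int d * ord_at a g)"
        unfolding of_int_0_le_iff .
      then show ?thesis
        using False g P by (simp add: ord_at_divide ord_at_mult ord_at_power ord_at_to_fract algebra_simps)
    qed
    then obtain p where p: "?F = to_fract p"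
      using eq_to_fract_of_ord_at_nonneg by blast
    have "Poly_Mapping.single n f ^ d = ev (const_tuv p * v_tuv ^ m)"
    proof -
      have "f ^ d = to_fract p * (to_fract P / g ^ d) ^ m"
        using g P by (simp add: p[symmetric] power_divide)
      then show ?thesis
        by (simp add: ev.hom_mult ev.hom_power ev_v ev_const_tuv cst_def single_power mult_single n mult.commute)
    qed
    then have "to_fract (Poly_Mapping.single n f) ^ d = to_fract (ev (const_tuv p * v_tuv ^ m))"
      by (simp flip: to_fract_power)
    then show ?thesis using d by (rule evK.integral_over_of_power)
  qed
qed

lemma integral_over_iff_mem:
  "integral_over (\<lambda>f. to_fract (ev f)) (to_fract y) \<longleftrightarrow> y \<in> carrier (dpd_algebra Dp Dm)"
proof
  assume y: "y \<in> carrier (dpd_algebra Dp Dm)"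
  have "to_fract y =
      (\<Sum>n\<in>Poly_Mapping.keys y. to_fract (Poly_Mapping.single n (Poly_Mapping.lookup y n)))"
    using laurent_eq_sum_single[of y] by (metis to_fract_sum)
  also have "integral_over (\<lambda>f. to_fract (ev f)) \<dots>"
    using y by (intro evK.integral_over_sum integral_over_single) (simp add: dpd_algebra_def)
  finally show "integral_over (\<lambda>f. to_fract (ev f)) (to_fract y)" .
qed (rule integral_over_imp_mem)

end

section \<open>The fraction field and the normalization\<close>

lemma ring_of_type_algebra_simps [simp]:
  "carrier ring_of_type_algebra = (UNIV :: 'a::comm_ring_1 set)"
  "x \<otimes>\<^bsub>ring_of_type_algebra\<^esub> y = (x * y :: 'a)"
  "x \<oplus>\<^bsub>ring_of_type_algebra\<^esub> y = (x + y :: 'a)"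
  "\<one>\<^bsub>ring_of_type_algebra\<^esub> = (1 :: 'a)"
  "\<zero>\<^bsub>ring_of_type_algebra\<^esub> = (0 :: 'a)"
  by (simp_all add: ring_of_type_algebra_def)

text \<open>The operations of \<open>fraction_field\<close> are unions over representatives; once
  the result is independent of these, the union collapses to a single class.\<close>

lemma UN_pair_eq_const:
  assumes "S \<noteq> {}" "T \<noteq> {}" "\<And>a b c e. (a, b) \<in> S \<Longrightarrow> (c, e) \<in> T \<Longrightarrow> f a b c e = R"
  shows "(\<Union>(a, b)\<in>S. \<Union>(c, e)\<in>T. f a b c e) = R"
proof -
  have "(\<Union>(a, b)\<in>S. \<Union>(c, e)\<in>T. f a b c e) = (\<Union>_\<in>S. \<Union>_\<in>T. R)"
    using assms(3) by (intro SUP_cong refl) (auto split: prod.split)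
  with assms(1,2) show ?thesis by simp
qed

context dpd_embedding
begin

abbreviation B where "B \<equiv> B_ring d P"
abbreviation cls where "cls \<equiv> B_class d P"

section \<open>The quotient ring \<open>B\<close> and its fraction field\<close>

text \<open>By \<open>ev_eq_0_iff\<close> the defining ideal is the kernel of \<open>ev\<close>.
  Residue classes are thus fibres of \<open>ev\<close>, and computations in \<open>B\<close> become
  computations with Laurent polynomials.\<close>

lemma B_ideal_eq: "B_ideal d P = {f. ev f = 0}"
  unfolding B_ideal_def cgenideal_def ev_eq_0_iff dvd_def by (auto simp: mult.commute)

lemma cls_eq: "cls f = {f'. ev f' = ev f}"
proof -
  have "\<exists>j. ev j = 0 \<and> f' = j + f" if "ev f' = ev f" for f'
    by (rule exI[of _ "f' - f"]) (simp add: that ev.hom_minus)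
  then show ?thesis
    unfolding B_class_def B_ideal_eq by (auto simp: a_r_coset_def' ev.hom_add)
qed

lemma cls_eq_iff: "cls f = cls f' \<longleftrightarrow> ev f = ev f'"
  unfolding cls_eq by force

lemma ideal_B_ideal: "ideal (B_ideal d P) ring_of_type_algebra"
proof -
  interpret R: cring "ring_of_type_algebra :: complex poly poly poly ring" ..
  show ?thesis unfolding B_ideal_def by (rule R.cgenideal_ideal) simp
qed

lemma carrier_B: "carrier B = range cls"
  by (auto simp: B_ring_def FactRing_def A_RCOSETS_def' B_class_def)

lemma B_mult: "cls f \<otimes>\<^bsub>B\<^esub> cls f' = cls (f * f')"
  and B_add: "cls f \<oplus>\<^bsub>B\<^esub> cls f' = cls (f + f')"
  and B_one: "\<one>\<^bsub>B\<^esub> = cls 1"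
  using ring_hom_memE[OF ideal.rcos_ring_hom[OF ideal_B_ideal]]
  by (simp_all add: B_class_def B_ring_def)

lemma B_zero: "\<zero>\<^bsub>B\<^esub> = cls 0"
  unfolding cls_eq by (simp add: B_ring_def FactRing_def B_ideal_eq)

text \<open>\<open>emb x\<close> is the element of \<open>Frac B\<close> corresponding to \<open>x\<close>, as the class of all its representations.\<close>

definition emb :: "laurent fract \<Rightarrow> (complex poly poly poly set \<times> complex poly poly poly set) set"
  where "emb x = {(cls a, cls b) | a b. ev b \<noteq> 0 \<and> to_fract (ev a) / to_fract (ev b) = x}"

text \<open>Cross-multiplication in \<open>B\<close> is, through \<open>ev\<close>, equality of
  quotients in the fraction field of the Laurent polynomials.\<close>

lemma fraction_cls:
  assumes "ev b \<noteq> 0"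
  shows "fraction B (cls a) (cls b) = emb (to_fract (ev a) / to_fract (ev b))"
proof -
  have *: "cls a \<otimes>\<^bsub>B\<^esub> cls b' = cls a' \<otimes>\<^bsub>B\<^esub> cls b \<longleftrightarrow>
      to_fract (ev a') / to_fract (ev b') = to_fract (ev a) / to_fract (ev b)" if "ev b' \<noteq> 0" for a' b'
  proof -
    have "cls a \<otimes>\<^bsub>B\<^esub> cls b' = cls a' \<otimes>\<^bsub>B\<^esub> cls b \<longleftrightarrow> ev a' * ev b = ev a * ev b'"
      by (auto simp: B_mult cls_eq_iff ev.hom_mult)
    also have "\<dots> \<longleftrightarrow> to_fract (ev a') * to_fract (ev b) = to_fract (ev a) * to_fract (ev b')"
      unfolding to_fract_mult[symmetric] to_fract_eq_iff ..
    finally show ?thesis using assms that by (simp add: frac_eq_eq)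
  qed
  have nz: "cls b' = cls 0 \<longleftrightarrow> ev b' = 0" for b'
    by (simp add: cls_eq_iff)
  have "(U, V) \<in> fraction B (cls a) (cls b) \<longleftrightarrow> (U, V) \<in> emb (to_fract (ev a) / to_fract (ev b))" for U V
  proof -
    have "(U, V) \<in> fraction B (cls a) (cls b) \<longleftrightarrow>
        U \<in> range cls \<and> V \<in> range cls \<and> V \<noteq> cls 0 \<and> cls a \<otimes>\<^bsub>B\<^esub> V = U \<otimes>\<^bsub>B\<^esub> cls b"
      using assms by (simp add: fraction_def fraction_rel_def carrier_B B_zero nz)
    also have "\<dots> \<longleftrightarrow> (\<exists>a' b'. U = cls a' \<and> V = cls b' \<and> ev b' \<noteq> 0 \<and>
        to_fract (ev a') / to_fract (ev b') = to_fract (ev a) / to_fract (ev b))"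
      using * nz by blast
    finally show ?thesis unfolding emb_def by simp
  qed
  then show ?thesis by auto
qed

text \<open>Numerator and denominator can even be chosen constant in \<open>v\<close>, since
  quotients from \<open>C[t][u]\<close> already give everything.\<close>

lemma emb_representation:
  obtains a b where "ev b \<noteq> 0" "x = to_fract (ev a) / to_fract (ev b)" "(cls a, cls b) \<in> emb x"
proof -
  obtain p q where pq: "q \<noteq> 0" "x = to_fract (iota p) / to_fract (iota q)"
    by (metis fract_laurent_eq_coprime_quotient)
  have "ev [:q:] \<noteq> 0" "x = to_fract (ev [:p:]) / to_fract (ev [:q:])"
    using pq by (simp_all add: ev_const iota_eq_0_iff)
  then show thesis
    by (intro that[of "[:q:]" "[:p:]"]) (auto simp: emb_def)
qed

lemma emb_memD:
  assumes "(U, V) \<in> emb x"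
  obtains a b where "U = cls a" "V = cls b" "ev b \<noteq> 0" "x = to_fract (ev a) / to_fract (ev b)"
  using assms unfolding emb_def by blast

lemma emb_inj: "inj emb"
proof (rule injI)
  fix x y assume xy: "emb x = emb y"
  obtain a b where ab: "x = to_fract (ev a) / to_fract (ev b)" "(cls a, cls b) \<in> emb x"
    by (rule emb_representation)
  then have "(cls a, cls b) \<in> emb y" using xy by simp
  with ab(1) show "x = y" by (elim emb_memD) (auto simp: cls_eq_iff)
qed

lemma carrier_fraction_field: "carrier (fraction_field B) = range emb"
proof -
  have "emb x \<in> carrier (fraction_field B)" for x
  proof -
    obtain a b where ab: "ev b \<noteq> 0" "x = to_fract (ev a) / to_fract (ev b)"
      by (rule emb_representation)
    then have "emb x = fraction B (cls a) (cls b)"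
      by (simp add: fraction_cls)
    moreover have "cls b \<noteq> cls 0" using ab(1) by (simp add: cls_eq_iff)
    ultimately show ?thesis
      unfolding fraction_field_def carrier_B B_zero by simp blast
  qed
  moreover have "z \<in> range emb" if z: "z \<in> carrier (fraction_field B)" for z
  proof -
    obtain a b where "z = fraction B (cls a) (cls b)" "cls b \<noteq> cls 0"
      using z by (simp add: fraction_field_def carrier_B B_zero) blast
    then have "z = fraction B (cls a) (cls b)" "ev b \<noteq> 0"
      by (simp_all add: cls_eq_iff)
    then show ?thesis by (simp add: fraction_cls)
  qed
  ultimately show ?thesis by blast
qed

lemma emb_nonempty: "emb x \<noteq> {}"
  using emb_representation[of x] by blast

lemma emb_mult: "emb x \<otimes>\<^bsub>fraction_field B\<^esub> emb y = emb (x * y)"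
proof -
  have "fraction B (a \<otimes>\<^bsub>B\<^esub> c) (b \<otimes>\<^bsub>B\<^esub> e) = emb (x * y)"
    if "(a, b) \<in> emb x" "(c, e) \<in> emb y" for a b c e
    using that by (elim emb_memD) (simp add: B_mult fraction_cls ev.hom_mult)
  then show ?thesis
    by (simp add: fraction_field_def) (intro UN_pair_eq_const emb_nonempty)
qed

lemma emb_add: "emb x \<oplus>\<^bsub>fraction_field B\<^esub> emb y = emb (x + y)"
proof -
  have "fraction B ((a \<otimes>\<^bsub>B\<^esub> e) \<oplus>\<^bsub>B\<^esub> (c \<otimes>\<^bsub>B\<^esub> b)) (b \<otimes>\<^bsub>B\<^esub> e) = emb (x + y)"
    if "(a, b) \<in> emb x" "(c, e) \<in> emb y" for a b c e
    using that by (elim emb_memD) (simp add: B_mult B_add fraction_cls ev.hom_mult ev.hom_add add_frac_eq)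
  then show ?thesis
    by (simp add: fraction_field_def) (intro UN_pair_eq_const emb_nonempty)
qed

lemma to_fraction_cls: "to_fraction B (cls a) = emb (to_fract (ev a))"
  unfolding to_fraction_def B_one by (simp add: fraction_cls)

lemma emb_one: "\<one>\<^bsub>fraction_field B\<^esub> = emb 1"
  using to_fraction_cls[of 1] by (simp add: fraction_field_def to_fraction_def B_one)

lemma emb_zero: "\<zero>\<^bsub>fraction_field B\<^esub> = emb 0"
  using to_fraction_cls[of 0] by (simp add: fraction_field_def to_fraction_def B_zero)

text \<open>Serves to transport the ring axioms to \<open>fraction_field B\<close>.\<close>

lemma emb_ring_iso: "emb \<in> ring_iso ring_of_type_algebra (fraction_field B)"
proof -
  have "emb \<in> Ring.ring_hom ring_of_type_algebra (fraction_field B)"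
    by (intro ring_hom_memI) (simp_all add: carrier_fraction_field emb_mult emb_add emb_one)
  then show ?thesis
    by (simp add: ring_iso_def bij_betw_def emb_inj carrier_fraction_field)
qed

lemma ring_fraction_field: "ring (fraction_field B)"
proof -
  interpret R: cring "ring_of_type_algebra :: laurent fract ring" ..
  show ?thesis
    using R.ring_iso_imp_img_ring[OF emb_ring_iso] by (simp flip: emb_zero)
qed

lemma emb_power: "emb x [^]\<^bsub>fraction_field B\<^esub> (n::nat) = emb (x ^ n)"
proof -
  interpret K: ring "fraction_field B" by (rule ring_fraction_field)
  show ?thesis
    by (induction n) (simp_all add: emb_one emb_mult mult.commute)
qed

text \<open>The list is reversed because \<open>eval\<close> expects the leading coefficient first,
  while \<open>Poly\<close> expects the constant one first.\<close>

lemma eval_emb: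
  "ring.eval (fraction_field B) (map (\<lambda>c. emb (to_fract (ev c))) cs) (emb x) =
    emb (poly (map_poly (\<lambda>f. to_fract (ev f)) (Poly (rev cs))) x)"
proof -
  interpret K: ring "fraction_field B" by (rule ring_fraction_field)
  interpret mp: map_poly_comm_ring_hom "\<lambda>f. to_fract (ev f)" ..
  show ?thesis
  proof (induction cs)
    case (Cons c cs)
    have "map_poly (\<lambda>f. to_fract (ev f)) (Poly (rev (c # cs))) =
        map_poly (\<lambda>f. to_fract (ev f)) (Poly (rev cs)) + Polynomial.monom (to_fract (ev c)) (length cs)"
      by (simp add: Poly_snoc mp.hom_add map_poly_monom)
    then show ?case
      by (simp add: Cons.IH emb_power emb_mult emb_add poly_monom add.commute)
  qed (simp add: emb_zero)
qed

text \<open>Coefficients lift only up to the kernel of \<open>ev\<close>. The tail is lifted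
  arbitrarily and the head to \<open>1\<close>, which keeps \<open>F\<close> monic.\<close>

lemma polynomial_of_monic_integral_list:
  assumes "polynomial\<^bsub>fraction_field B\<^esub> (to_fraction B ` carrier B) p" "p \<noteq> []"
    "hd p = \<one>\<^bsub>fraction_field B\<^esub>"
  obtains F where "Polynomial.lead_coeff F = 1" "p = map (\<lambda>c. emb (to_fract (ev c))) (rev (Polynomial.coeffs F))"
proof -
  have "set p \<subseteq> range (\<lambda>c. emb (to_fract (ev c)))"
    using assms by (auto simp: polynomial_def carrier_B to_fraction_cls)
  then have "set (tl p) \<subseteq> range (\<lambda>c. emb (to_fract (ev c)))"
    using assms(2) by (cases p) auto
  then have "\<exists>cs. tl p = map (\<lambda>c. emb (to_fract (ev c))) cs"
    unfolding ex_map_conv by blast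
  then obtain cs where cs: "tl p = map (\<lambda>c. emb (to_fract (ev c))) cs" ..
  let ?F = "Poly (rev cs @ [1])"
  have "Polynomial.coeffs ?F = rev cs @ [1]" by (simp add: coeffs_Poly)
  then have "p = map (\<lambda>c. emb (to_fract (ev c))) (rev (Polynomial.coeffs ?F))"
    using assms(2,3) cs by (cases p) (simp_all add: emb_one)
  moreover have "Polynomial.lead_coeff ?F = 1"
    using last_coeffs_eq_coeff_degree[of ?F] \<open>Polynomial.coeffs ?F = _\<close>
    by (metis coeffs_eq_Nil last_snoc snoc_eq_iff_butlast)
  ultimately show thesis by (rule that[rotated])
qed

lemma carrier_normalization:
  "carrier (normalization B) = emb ` to_fract ` carrier (dpd_algebra Dp Dm)"
proof -
  have "emb x \<in> carrier (normalization B) \<longleftrightarrow> integral_over (\<lambda>f. to_fract (ev f)) x" for x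
  proof
    assume "emb x \<in> carrier (normalization B)"
    then obtain p where p: "polynomial\<^bsub>fraction_field B\<^esub> (to_fraction B ` carrier B) p" "p \<noteq> []"
      "hd p = \<one>\<^bsub>fraction_field B\<^esub>" "ring.eval (fraction_field B) p (emb x) = \<zero>\<^bsub>fraction_field B\<^esub>"
      by (auto simp: normalization_def integral_closure_def)
    obtain F where F: "Polynomial.lead_coeff F = 1" "p = map (\<lambda>c. emb (to_fract (ev c))) (rev (Polynomial.coeffs F))"
      using polynomial_of_monic_integral_list[OF p(1-3)] by blast
    have "emb (poly (map_poly (\<lambda>f. to_fract (ev f)) F) x) = emb 0"
      using p(4) unfolding F(2) eval_emb emb_zero by simp
    then have "poly (map_poly (\<lambda>f. to_fract (ev f)) F) x = 0"
      by (rule injD[OF emb_inj])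
    with F(1) show "integral_over (\<lambda>f. to_fract (ev f)) x"
      unfolding integral_over_def by blast
  next
    assume "integral_over (\<lambda>f. to_fract (ev f)) x"
    then obtain F where F: "Polynomial.lead_coeff F = 1" "poly (map_poly (\<lambda>f. to_fract (ev f)) F) x = 0"
      unfolding integral_over_def by blast
    let ?p = "map (\<lambda>c. emb (to_fract (ev c))) (rev (Polynomial.coeffs F))"
    have "F \<noteq> 0" using F(1) by auto
    then have ne: "Polynomial.coeffs F \<noteq> []" by simp
    then have hd: "hd ?p = \<one>\<^bsub>fraction_field B\<^esub>"
      using F(1) \<open>F \<noteq> 0\<close> by (simp add: hd_map hd_rev last_coeffs_eq_coeff_degree emb_one)
    \<comment> \<open>A nonempty list counts as a polynomial only if its head is nonzero.\<close>
    moreover have "\<one>\<^bsub>fraction_field B\<^esub> \<noteq> \<zero>\<^bsub>fraction_field B\<^esub>"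
      unfolding emb_one emb_zero inj_eq[OF emb_inj] by simp
    moreover have "set ?p \<subseteq> to_fraction B ` carrier B"
      unfolding carrier_B image_image to_fraction_cls by auto
    ultimately have "polynomial\<^bsub>fraction_field B\<^esub> (to_fraction B ` carrier B) ?p"
      unfolding polynomial_def by metis
    moreover have "ring.eval (fraction_field B) ?p (emb x) = \<zero>\<^bsub>fraction_field B\<^esub>"
      unfolding eval_emb emb_zero using F(2) by simp
    ultimately show "emb x \<in> carrier (normalization B)"
      using hd ne by (auto simp: normalization_def integral_closure_def carrier_fraction_field intro!: exI[of _ ?p])
  qed
  moreover have "carrier (normalization B) \<subseteq> range emb"
    by (auto simp: normalization_def integral_closure_def carrier_fraction_field)
  ultimately have "carrier (normalization B) = emb ` {x. integral_over (\<lambda>f. to_fract (ev f)) x}"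
    by blast
  also have "{x. integral_over (\<lambda>f. to_fract (ev f)) x} = to_fract ` carrier (dpd_algebra Dp Dm)"
    using integral_over_iff_mem integral_over_imp_laurent by blast
  finally show ?thesis .
qed

lemma A_dP_simps:
  "carrier (A_dP d P) = emb ` to_fract ` carrier (dpd_algebra Dp Dm)"
  "emb x \<otimes>\<^bsub>A_dP d P\<^esub> emb y = emb (x * y)"
  "emb x \<oplus>\<^bsub>A_dP d P\<^esub> emb y = emb (x + y)"
  "\<one>\<^bsub>A_dP d P\<^esub> = emb 1"
  "p \<odot>\<^bsub>A_dP d P\<^esub> emb x = emb (to_fract (cst p) * x)"
  by (simp_all add: A_dP_def Let_def carrier_normalization[symmetric] to_fraction_cls ev_const_tuv)
    (simp_all add: normalization_def emb_mult[simplified] emb_add[simplified] emb_one[simplified])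

section \<open>The grading of the normalization\<close>

lemma ev_homogeneous:
  "homogeneous_tuv d k f \<Longrightarrow> \<exists>c. ev f = Poly_Mapping.single k c"
proof (induction f arbitrary: k)
  case 0
  then show ?case by (auto intro: exI[of _ 0])
next
  case (pCons s f)
  have deg_s: "int i = k" if "Polynomial.coeff s i \<noteq> 0" for i
    using pCons.prems[unfolded homogeneous_tuv_def, rule_format, of 0 i] that by simp
  have "iota s = Poly_Mapping.single k (to_fract (Polynomial.coeff s (nat k)) * g ^ nat k) \<or> iota s = 0"
  proof (cases "s = 0")
    case False
    then have "0 \<le> k" using deg_s[of "Polynomial.degree s"] by auto
    show ?thesis
    proof (intro disjI1 poly_mapping_eqI)
      fix n
      show "Poly_Mapping.lookup (iota s) n =
          Poly_Mapping.lookup (Poly_Mapping.single k (to_fract (Polynomial.coeff s (nat k)) * g ^ nat k)) n"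
        using deg_s[of "nat n"] \<open>0 \<le> k\<close>
        by (auto simp: lookup_iota lookup_single when_def)
    qed
  qed simp
  then obtain c where c: "iota s = Poly_Mapping.single k c"
    by (metis single_zero)
  \<comment> \<open>Dropping one factor \<open>v\<close>, of weight \<open>-d\<close>, raises the
    degree by \<open>d\<close>.\<close>
  have "int i - int d * int j = k + int d" if "Polynomial.coeff (Polynomial.coeff f j) i \<noteq> 0" for i j
  proof -
    have "Polynomial.coeff (Polynomial.coeff (pCons s f) (Suc j)) i \<noteq> 0" using that by simp
    then have "int i - int d * int (Suc j) = k"
      using pCons.prems unfolding homogeneous_tuv_def by blast
    then show ?thesis by (simp add: algebra_simps)
  qed
  then have "homogeneous_tuv d (k + int d) f" by (simp add: homogeneous_tuv_def)
  then obtain c' where "ev f = Poly_Mapping.single (k + int d) c'"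
    using pCons.IH by blast
  then have "ev (pCons s f) = Poly_Mapping.single k (c + to_fract P / g ^ d * c')"
    by (simp add: ev_pCons c mult_single single_add)
  then show ?case ..
qed

lemma homogeneous_monom: "homogeneous_tuv d (int i) [:Polynomial.monom p i:]"
  by (auto simp: homogeneous_tuv_def coeff_pCons split: nat.splits if_splits)

text \<open>Homogeneous elements of \<open>B\<close> map to monomials, and nonzero monomials are
  units, so homogeneous fractions are monomials. The converse is
  \<open>single_homogeneous_quotient\<close>.\<close>

lemma gpart_A_dP:
  "gpart (A_dP d P) n = emb ` to_fract ` (carrier (dpd_algebra Dp Dm) \<inter> range (Poly_Mapping.single n))"
proof (intro equalityI subsetI)
  fix z assume "z \<in> gpart (A_dP d P) n"
  then obtain a b k m where z: "z \<in> carrier (normalization B)" "z = fraction B a b"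
    "a \<in> B_piece d P k" "b \<in> B_piece d P m" "b \<noteq> \<zero>\<^bsub>B\<^esub>" "k - m = n"
    by (auto simp: A_dP_def Let_def)
  obtain y where y: "y \<in> carrier (dpd_algebra Dp Dm)" "z = emb (to_fract y)"
    using z(1) unfolding carrier_normalization by blast
  obtain a' b' where ab: "a = cls a'" "b = cls b'" "homogeneous_tuv d k a'" "homogeneous_tuv d m b'"
    using z(3,4) by (auto simp: B_piece_def)
  obtain c c' where c: "ev a' = Poly_Mapping.single k c" "ev b' = Poly_Mapping.single m c'"
    using ab(3,4) ev_homogeneous by metis
  have b': "ev b' \<noteq> 0" using z(5) by (auto simp: ab B_zero cls_eq_iff)
  then have c': "c' \<noteq> 0" using c by auto
  have "emb (to_fract y) = emb (to_fract (ev a') / to_fract (ev b'))"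
    using z(2) y(2) b' by (simp add: ab fraction_cls)
  then have "to_fract y = to_fract (ev a') / to_fract (ev b')"
    by (rule injD[OF emb_inj])
  then have "to_fract (y * ev b') = to_fract (ev a')"
    using b' by simp
  then have "y * Poly_Mapping.single m c' = Poly_Mapping.single k c"
    unfolding to_fract_eq_iff c .
  \<comment> \<open>The denominator is a unit with inverse of degree \<open>-m\<close>, so it can be
    moved to the other side.\<close>
  then have "y * Poly_Mapping.single m c' * Poly_Mapping.single (- m) (inverse c') =
      Poly_Mapping.single k c * Poly_Mapping.single (- m) (inverse c')"
    by simp
  then have "y = Poly_Mapping.single n (c * inverse c')"
    using c' z(6) by (simp add: mult.assoc mult_single)
  with y show "z \<in> emb ` to_fract ` (carrier (dpd_algebra Dp Dm) \<inter> range (Poly_Mapping.single n))"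
    by blast
next
  fix z assume "z \<in> emb ` to_fract ` (carrier (dpd_algebra Dp Dm) \<inter> range (Poly_Mapping.single n))"
  then obtain f where f: "z = emb (to_fract (Poly_Mapping.single n f))"
    "Poly_Mapping.single n f \<in> carrier (dpd_algebra Dp Dm)"
    by blast
  obtain p q i j where pq: "q \<noteq> 0" "n = int i - int j"
    "Poly_Mapping.single n f * iota (Polynomial.monom q j) = iota (Polynomial.monom p i)"
    by (rule single_homogeneous_quotient)
  let ?a = "[:Polynomial.monom p i:]" and ?b = "[:Polynomial.monom q j:]"
  have b: "ev ?b \<noteq> 0" using pq(1) by (simp add: ev_const iota_eq_0_iff)
  have "to_fract (Poly_Mapping.single n f) * to_fract (ev ?b) = to_fract (ev ?a)"
    unfolding to_fract_mult[symmetric] ev_const pq(3) ..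
  moreover have "to_fract (ev ?b) \<noteq> 0" using b by simp
  ultimately have "to_fract (Poly_Mapping.single n f) = to_fract (ev ?a) / to_fract (ev ?b)"
    by (metis nonzero_eq_divide_eq)
  then have "z = fraction B (cls ?a) (cls ?b)"
    unfolding fraction_cls[OF b] f(1) by simp
  moreover have "cls ?b \<noteq> \<zero>\<^bsub>B\<^esub>" using b by (simp add: B_zero cls_eq_iff)
  moreover have "cls ?a \<in> B_piece d P (int i)" "cls ?b \<in> B_piece d P (int j)"
    unfolding B_piece_def using homogeneous_monom by auto
  moreover have "z \<in> carrier (normalization B)"
    using f unfolding carrier_normalization by blast
  ultimately show "z \<in> gpart (A_dP d P) n"
    unfolding A_dP_def Let_def using pq(2) by simp blast
qed

lemma dpd_piece_eq: "dpd_piece Dp Dm n = carrier (dpd_algebra Dp Dm) \<inter> range (Poly_Mapping.single n)"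
  by (auto simp: dpd_piece_def dpd_algebra_def lookup_single when_def mem_dpd_coeffs[of 0] split: if_splits)

lemma graded_isomorphic_A_dP: "graded_isomorphic (dpd_algebra Dp Dm) (A_dP d P)"
proof -
  let ?A = "dpd_algebra Dp Dm"
  have [simp]: "x \<otimes>\<^bsub>?A\<^esub> y = x * y" "x \<oplus>\<^bsub>?A\<^esub> y = x + y" "\<one>\<^bsub>?A\<^esub> = 1"
    "p \<odot>\<^bsub>?A\<^esub> x = cst p * x" "gpart ?A = dpd_piece Dp Dm" for x y p
    by (simp_all add: dpd_algebra_def cst_def)
  let ?F = "\<lambda>y. emb (to_fract y)"
  have "inj_on ?F (carrier ?A)"
    by (intro inj_onI) (auto dest: injD[OF emb_inj])
  then have "?F \<in> ring_iso ?A (A_dP d P)"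
    by (auto simp: ring_iso_def bij_betw_def A_dP_simps image_image intro!: ring_hom_memI)
  then have "?F \<in> graded_algebra_iso ?A (A_dP d P)"
    by (auto simp: graded_algebra_iso_def A_dP_simps gpart_A_dP dpd_piece_eq)
  then show ?thesis unfolding graded_isomorphic_def by blast
qed

end

section \<open>Graded isomorphisms\<close>

definition graded_closed :: "('k, 'a) graded_algebra \<Rightarrow> bool"
  where "graded_closed R \<longleftrightarrow> \<one>\<^bsub>R\<^esub> \<in> carrier R \<and>
    (\<forall>x\<in>carrier R. \<forall>y\<in>carrier R. x \<otimes>\<^bsub>R\<^esub> y \<in> carrier R \<and> x \<oplus>\<^bsub>R\<^esub> y \<in> carrier R) \<and>
    (\<forall>c. \<forall>x\<in>carrier R. c \<odot>\<^bsub>R\<^esub> x \<in> carrier R) \<and> (\<forall>n. gpart R n \<subseteq> carrier R)"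

text \<open>The inverse function is controlled only on the carrier, so its compatibility with the
  operations needs \<open>R\<close> to be closed under them.\<close>

lemma graded_isomorphic_sym:
  assumes R: "graded_closed R" and "graded_isomorphic R S"
  shows "graded_isomorphic S R"
proof -
  obtain f where f: "f \<in> graded_algebra_iso R S"
    using assms unfolding graded_isomorphic_def by blast
  then have hom: "f \<in> Ring.ring_hom R S" and bij: "bij_betw f (carrier R) (carrier S)"
    and smult: "\<And>c x. x \<in> carrier R \<Longrightarrow> f (c \<odot>\<^bsub>R\<^esub> x) = c \<odot>\<^bsub>S\<^esub> f x"
    and gpart: "\<And>n. f ` gpart R n = gpart S n"
    by (auto simp: graded_algebra_iso_def ring_iso_def)
  let ?f = "inv_into (carrier R) f"
  have eqI: "?f y = x" if "x \<in> carrier R" "y = f x" for x y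
    using that bij by (simp add: bij_betw_def inv_into_f_f)
  have img: "\<exists>x\<in>carrier R. y = f x" if "y \<in> carrier S" for y
    using that bij by (auto simp: bij_betw_def)
  have "?f \<in> Ring.ring_hom S R"
  proof (rule ring_hom_memI)
    fix y z assume "y \<in> carrier S" "z \<in> carrier S"
    then obtain x x' where x: "x \<in> carrier R" "x' \<in> carrier R" "y = f x" "z = f x'"
      using img by metis
    have f: "?f y = x" "?f z = x'" using x eqI by auto
    show "?f y \<in> carrier R" unfolding f by (rule x)
    show "?f (y \<otimes>\<^bsub>S\<^esub> z) = ?f y \<otimes>\<^bsub>R\<^esub> ?f z"
      unfolding f using R ring_hom_mult[OF hom x(1,2)] x by (intro eqI) (simp_all add: graded_closed_def)
    show "?f (y \<oplus>\<^bsub>S\<^esub> z) = ?f y \<oplus>\<^bsub>R\<^esub> ?f z"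
      unfolding f using R ring_hom_add[OF hom x(1,2)] x by (intro eqI) (simp_all add: graded_closed_def)
  next
    show "?f \<one>\<^bsub>S\<^esub> = \<one>\<^bsub>R\<^esub>"
      using R ring_hom_one[OF hom] by (intro eqI) (auto simp: graded_closed_def)
  qed
  moreover have "bij_betw ?f (carrier S) (carrier R)"
    using bij by (rule bij_betw_inv_into)
  moreover have "?f (c \<odot>\<^bsub>S\<^esub> y) = c \<odot>\<^bsub>R\<^esub> ?f y" if "y \<in> carrier S" for c y
  proof -
    obtain x where x: "x \<in> carrier R" "y = f x" using img[OF \<open>y \<in> carrier S\<close>] by blast
    then have "?f y = x" by (intro eqI)
    with x R show ?thesis
      by (simp only:) (intro eqI, simp_all add: graded_closed_def smult)
  qed
  moreover have "?f ` gpart S n = gpart R n" for n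
  proof -
    have "gpart R n \<subseteq> carrier R" using R by (auto simp: graded_closed_def)
    then show ?thesis
      unfolding gpart[symmetric] using bij by (simp add: bij_betw_def inv_into_image_cancel)
  qed
  ultimately show ?thesis
    unfolding graded_isomorphic_def graded_algebra_iso_def ring_iso_def by blast
qed

text \<open>Here \<open>w 1\<close> is a generator of degree one and \<open>w n\<close> its powers, except that \<open>w 0\<close> need not be the unit.\<close>

definition power_generated :: "('k, 'a) graded_algebra \<Rightarrow> bool"
  where "power_generated R \<longleftrightarrow> (\<exists>w. \<forall>n. w n \<in> carrier R \<and> w (Suc n) = w n \<otimes>\<^bsub>R\<^esub> w 1 \<and>
    gpart R (int n) = range (\<lambda>c. c \<odot>\<^bsub>R\<^esub> w n))"

lemma power_generated_iso:
  assumes "graded_isomorphic R S" "power_generated R"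
  shows "power_generated S"
proof -
  obtain f where f: "f \<in> graded_algebra_iso R S"
    using assms unfolding graded_isomorphic_def by blast
  obtain w where w: "\<And>n. w n \<in> carrier R" "\<And>n. w (Suc n) = w n \<otimes>\<^bsub>R\<^esub> w 1"
    "\<And>n. gpart R (int n) = range (\<lambda>c. c \<odot>\<^bsub>R\<^esub> w n)"
    using assms(2) unfolding power_generated_def by metis
  have hom: "f \<in> Ring.ring_hom R S"
    using f by (simp add: graded_algebra_iso_def ring_iso_def)
  have "f (w n) \<in> carrier S \<and> f (w (Suc n)) = f (w n) \<otimes>\<^bsub>S\<^esub> f (w 1) \<and>
      gpart S (int n) = range (\<lambda>c. c \<odot>\<^bsub>S\<^esub> f (w n))" for n
  proof (intro conjI)
    show "f (w n) \<in> carrier S" using w(1) by (rule ring_hom_closed[OF hom])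
    show "f (w (Suc n)) = f (w n) \<otimes>\<^bsub>S\<^esub> f (w 1)"
      unfolding w(2) using w(1) by (intro ring_hom_mult[OF hom])
    have "gpart S (int n) = f ` gpart R (int n)"
      using f by (simp add: graded_algebra_iso_def)
    also have "\<dots> = range (\<lambda>c. f (c \<odot>\<^bsub>R\<^esub> w n))"
      unfolding w(3) image_image ..
    also have "\<dots> = range (\<lambda>c. c \<odot>\<^bsub>S\<^esub> f (w n))"
      using f w(1) by (simp add: graded_algebra_iso_def)
    finally show "gpart S (int n) = range (\<lambda>c. c \<odot>\<^bsub>S\<^esub> f (w n))" .
  qed
  then show ?thesis unfolding power_generated_def by (intro exI[of _ "\<lambda>n. f (w n)"]) blast
qed

lemma dpd_algebra_simps [simp]:
  "x \<otimes>\<^bsub>dpd_algebra Dp Dm\<^esub> y = x * y"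
  "x \<oplus>\<^bsub>dpd_algebra Dp Dm\<^esub> y = x + y"
  "\<one>\<^bsub>dpd_algebra Dp Dm\<^esub> = 1"
  "p \<odot>\<^bsub>dpd_algebra Dp Dm\<^esub> x = Poly_Mapping.single 0 (to_fract p) * x"
  "gpart (dpd_algebra Dp Dm) = dpd_piece Dp Dm"
  by (simp_all add: dpd_algebra_def)

lemma nonneg_part_simps [simp]:
  "x \<otimes>\<^bsub>nonneg_part R\<^esub> y = x \<otimes>\<^bsub>R\<^esub> y"
  "x \<oplus>\<^bsub>nonneg_part R\<^esub> y = x \<oplus>\<^bsub>R\<^esub> y"
  "\<one>\<^bsub>nonneg_part R\<^esub> = \<one>\<^bsub>R\<^esub>"
  "p \<odot>\<^bsub>nonneg_part R\<^esub> x = p \<odot>\<^bsub>R\<^esub> x"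
  "gpart (nonneg_part R) n = (if 0 \<le> n then gpart R n else {0})"
  "carrier (nonneg_part R) = {x \<in> carrier R. \<forall>n<0. Poly_Mapping.lookup x n = 0}"
  by (simp_all add: nonneg_part_def)

lemma dpd_piece_subset_carrier: "dpd_piece Dp Dm n \<subseteq> carrier (dpd_algebra Dp Dm)"
  by (auto simp: dpd_piece_def dpd_algebra_def lookup_single when_def mem_dpd_coeffs[of 0])

lemma graded_closed_dpd_algebra:
  assumes "qdiv_le (Dp + Dm) 0"
  shows "graded_closed (dpd_algebra Dp Dm)"
proof -
  have mult: "x * y \<in> carrier (dpd_algebra Dp Dm)"
    if "x \<in> carrier (dpd_algebra Dp Dm)" "y \<in> carrier (dpd_algebra Dp Dm)" for x y
    unfolding mem_carrier_dpd_algebra[OF assms]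
  proof (intro allI conjI)
    fix a
    show "val_ge a (Poly_Mapping.lookup Dp a) 0 (x * y)" "val_ge a (- Poly_Mapping.lookup Dm a) 0 (x * y)"
      using that val_ge_mult[of a _ 0 x 0 y] unfolding mem_carrier_dpd_algebra[OF assms] by simp_all
  qed
  have add: "x + y \<in> carrier (dpd_algebra Dp Dm)"
    if "x \<in> carrier (dpd_algebra Dp Dm)" "y \<in> carrier (dpd_algebra Dp Dm)" for x y
    using that val_ge_add unfolding mem_carrier_dpd_algebra[OF assms] by blast
  have const: "Poly_Mapping.single 0 (to_fract p) \<in> carrier (dpd_algebra Dp Dm)" for p
    unfolding mem_carrier_dpd_algebra[OF assms] val_ge_single
    by (cases "p = 0") (auto simp: ord_at_to_fract)
  have "1 \<in> carrier (dpd_algebra Dp Dm)"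
    using const[of 1] by simp
  with mult add const show ?thesis
    unfolding graded_closed_def dpd_algebra_simps using dpd_piece_subset_carrier by blast
qed

lemma graded_closed_nonneg_part:
  assumes "qdiv_le (Dp + Dm) 0"
  shows "graded_closed (nonneg_part (dpd_algebra Dp Dm))"
proof -
  have "Poly_Mapping.lookup (x * y) n = 0"
    if "\<forall>n<0. Poly_Mapping.lookup x n = 0" "\<forall>n<0. Poly_Mapping.lookup y n = 0" "n < 0"
    for x y :: laurent and n
    unfolding lookup_times_int
  proof (rule sum.neutral, rule ballI)
    fix i assume "i \<in> Poly_Mapping.keys x"
    then have "0 \<le> i" using that(1) by (metis in_keys_iff not_le)
    then have "n - i < 0" using that(3) by linarith
    then show "Poly_Mapping.lookup x i * Poly_Mapping.lookup y (n - i) = 0"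
      using that by simp
  qed
  moreover have "Poly_Mapping.lookup x m = 0" if "x \<in> dpd_piece Dp Dm n" "0 \<le> n" "m < 0" for x n m
    using that by (auto simp: dpd_piece_def lookup_single when_def)
  moreover have "0 \<in> carrier (dpd_algebra Dp Dm)"
    by (simp add: mem_carrier_dpd_algebra[OF assms])
  ultimately show ?thesis
    using graded_closed_dpd_algebra[OF assms]
    unfolding graded_closed_def nonneg_part_simps dpd_algebra_simps
    by (auto simp: lookup_add lookup_one lookup_single_times when_def)
qed

section \<open>Generation by powers forces an integral divisor\<close>

lemma qdiv_frac_eq_0_iff: "qdiv_frac D = 0 \<longleftrightarrow> (\<forall>a. Poly_Mapping.lookup D a \<in> \<int>)"
  by (auto simp: poly_mapping_eq_iff fun_eq_iff lookup_qdiv_frac)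

lemma common_denominator:
  fixes q :: "'a \<Rightarrow> rat"
  assumes "finite S"
  obtains N :: nat where "N \<noteq> 0" "\<And>a. a \<in> S \<Longrightarrow> of_nat N * q a \<in> \<int>"
proof -
  have "\<exists>N::nat. N \<noteq> 0 \<and> (\<forall>a\<in>S. of_nat N * q a \<in> \<int>)"
    using assms
  proof (induction S)
    case empty
    show ?case by (intro exI[of _ 1]) simp
  next
    case (insert b S)
    then obtain N :: nat where N: "N \<noteq> 0" "\<forall>a\<in>S. of_nat N * q a \<in> \<int>" by blast
    obtain m n where mn: "q b = Rat.Fract m n" "0 < n"
      by (cases "q b") auto
    have "of_nat (nat n * N) * q b = of_int (int N * m)"
      using mn by (simp add: Fract_of_int_quotient)
    then have "of_nat (nat n * N) * q b \<in> \<int>"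
      by (metis Ints_of_int)
    moreover have "of_nat (nat n * N) * q a \<in> \<int>" if "a \<in> S" for a
    proof -
      have "of_nat (nat n * N) * q a = of_nat (nat n) * (of_nat N * q a)" by simp
      also have "\<dots> \<in> \<int>" using Ints_mult[OF Ints_of_nat] N(2) that by blast
      finally show ?thesis .
    qed
    ultimately show ?case
      using N(1) mn(2) by (intro exI[of _ "nat n * N"]) auto
  qed
  with that show thesis by blast
qed

text \<open>The quotient of two polynomials, one for the positive and one for the negative part of
  the divisor.\<close>

lemma exists_fract_with_orders:
  fixes k :: "complex \<Rightarrow> int"
  assumes "finite {a. k a \<noteq> 0}"
  obtains f where "f \<noteq> 0" "\<And>a. ord_at a f = k a"
proof -
  let ?S = "{a. k a \<noteq> 0}"
  obtain P :: "complex poly" where P: "Polynomial.lead_coeff P = 1"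
    "\<And>a. Polynomial.order a P = (if a \<in> ?S then nat (k a) else 0)"
    using exists_monic_with_orders[OF assms, where k = "\<lambda>a. nat (k a)"] by blast
  obtain Q :: "complex poly" where Q: "Polynomial.lead_coeff Q = 1"
    "\<And>a. Polynomial.order a Q = (if a \<in> ?S then nat (- k a) else 0)"
    using exists_monic_with_orders[OF assms, where k = "\<lambda>a. nat (- k a)"] by blast
  have nz: "P \<noteq> 0" "Q \<noteq> 0" using P(1) Q(1) by auto
  show thesis
  proof
    show "to_fract P / to_fract Q \<noteq> 0" using nz by simp
    show "ord_at a (to_fract P / to_fract Q) = k a" for a
      using nz by (auto simp: ord_at_divide ord_at_to_fract P(2) Q(2))
  qed
qed

text \<open>
  If \<open>A\<^sub>n = A\<^sub>0 w\<^sup>n\<close> with \<open>w = f u\<close> and \<open>N D\<^sub>+\<close> is integral, then a generator of \<open>A\<^sub>N\<close> has divisor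
  \<open>- N D\<^sub>+\<close> and is a multiple of \<open>f\<^sup>N\<close>, so that \<open>div f \<le> - D\<^sub>+\<close>. As \<open>f u \<in> A\<^sub>1\<close>, equality holds.
\<close>

lemma integral_of_power_generated:
  assumes "power_generated (dpd_algebra Dp Dm)"
  shows "qdiv_frac Dp = 0"
proof -
  obtain w where w: "\<And>n. w (Suc n) = w n * w 1"
    "\<And>n. dpd_piece Dp Dm (int n) = range (\<lambda>c. Poly_Mapping.single 0 (to_fract c) * w n)"
    using assms unfolding power_generated_def dpd_algebra_simps by metis
  have "w 1 \<in> dpd_piece Dp Dm 1"
    using w(2)[of 1] by (auto intro!: image_eqI[of _ _ 1])
  then obtain f where f: "w 1 = Poly_Mapping.single 1 f" "f \<in> dpd_coeffs Dp Dm 1"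
    by (auto simp: dpd_piece_def)
  \<comment> \<open>The induction starts in degree one because \<open>w 0\<close> need not be the
    unit.\<close>
  have wn: "w (Suc n) = Poly_Mapping.single (int (Suc n)) (f ^ Suc n)" for n
  proof (induction n)
    case (Suc n)
    show ?case
      unfolding w(1)[of "Suc n"] Suc.IH f(1) mult_single by (simp add: algebra_simps)
  qed (use f in simp)
  obtain N :: nat where N: "N \<noteq> 0" "\<And>a. a \<in> Poly_Mapping.keys Dp \<Longrightarrow> of_nat N * Poly_Mapping.lookup Dp a \<in> \<int>"
    using common_denominator[OF finite_keys, where q = "Poly_Mapping.lookup Dp"] by metis
  \<comment> \<open>The orders of a function with divisor \<open>- N Dp\<close>; the floor changes
    nothing, by the choice of \<open>N\<close>.\<close>
  define k where "k a = - \<lfloor>of_nat N * Poly_Mapping.lookup Dp a\<rfloor>" for a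
  have k: "of_int (k a) = - (of_nat N * Poly_Mapping.lookup Dp a)" for a
  proof (cases "a \<in> Poly_Mapping.keys Dp")
    case True
    then show ?thesis using N(2)[OF True] by (simp add: k_def)
  qed (simp add: k_def in_keys_iff)
  have "{a. k a \<noteq> 0} \<subseteq> Poly_Mapping.keys Dp"
    by (auto simp: k_def in_keys_iff)
  then have "finite {a. k a \<noteq> 0}"
    by (rule finite_subset) simp
  then obtain h where h: "h \<noteq> 0" "\<And>a. ord_at a h = k a"
    using exists_fract_with_orders by blast
  have "h \<in> dpd_coeffs Dp Dm (int N)"
    by (simp add: mem_dpd_coeffs h k)
  then have "Poly_Mapping.single (int N) h \<in> dpd_piece Dp Dm (int N)"
    by (simp add: dpd_piece_def)
  then obtain c where "Poly_Mapping.single (int N) h = Poly_Mapping.single 0 (to_fract c) * w N"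
    unfolding w(2) by blast
  also have "w N = Poly_Mapping.single (int N) (f ^ N)"
    using wn[of "N - 1"] N(1) by simp
  finally have "Poly_Mapping.single (int N) h = Poly_Mapping.single (int N) (to_fract c * f ^ N)"
    by (simp add: mult_single)
  then have hc: "h = to_fract c * f ^ N"
    by (metis lookup_single_eq)
  then have nz: "c \<noteq> 0" "f \<noteq> 0"
    using h(1) N(1) by auto
  have "Poly_Mapping.lookup Dp a = of_int (- ord_at a f)" for a
  proof (rule antisym)
    \<comment> \<open>The polynomial factor \<open>c\<close> has no poles.\<close>
    have "int N * ord_at a f \<le> ord_at a h"
      using nz by (simp add: hc ord_at_mult ord_at_power ord_at_to_fract)
    then have "of_int (int N * ord_at a f) \<le> (of_int (k a) :: rat)"
      unfolding h(2) of_int_le_iff .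
    then have "of_nat N * Poly_Mapping.lookup Dp a \<le> of_nat N * - of_int (ord_at a f)"
      unfolding k by simp
    then show "Poly_Mapping.lookup Dp a \<le> of_int (- ord_at a f)"
      using N(1) by (simp add: mult_le_cancel_left_pos del: mult_minus_right)
    show "of_int (- ord_at a f) \<le> Poly_Mapping.lookup Dp a"
      using f(2) nz by (auto simp: mem_dpd_coeffs dest!: spec[of _ a])
  qed
  then show ?thesis
    unfolding qdiv_frac_eq_0_iff by simp
qed

lemma poly_algebra_simps [simp]:
  "x \<otimes>\<^bsub>poly_algebra\<^esub> y = x * y"
  "x \<oplus>\<^bsub>poly_algebra\<^esub> y = x + y"
  "\<one>\<^bsub>poly_algebra\<^esub> = 1"
  "p \<odot>\<^bsub>poly_algebra\<^esub> x = Polynomial.smult p x"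
  "gpart poly_algebra n = (if 0 \<le> n then range (\<lambda>p. Polynomial.monom p (nat n)) else {0})"
  "carrier poly_algebra = UNIV"
  by (simp_all add: poly_algebra_def)

lemma power_generated_poly_algebra: "power_generated poly_algebra"
  unfolding power_generated_def
  by (intro exI[of _ "\<lambda>n. Polynomial.monom 1 n"]) (simp add: mult_monom smult_monom)

lemma graded_closed_poly_algebra: "graded_closed poly_algebra"
  by (simp add: graded_closed_def)

context dpd_embedding
begin

lemma dpd_piece_nonneg: "dpd_piece Dp Dm (int n) = range (\<lambda>p. iota (Polynomial.monom p n))"
  unfolding dpd_piece_def iota_monom dpd_coeffs_nonneg[OF of_nat_0_le_iff] by auto

lemma power_generated_dpd_algebra: "power_generated (dpd_algebra Dp Dm)"
  unfolding power_generated_def dpd_algebra_simps dpd_piece_nonneg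
proof (intro exI[of _ "\<lambda>n. iota (Polynomial.monom 1 n)"] allI conjI)
  fix n
  have "iota (Polynomial.monom 1 n) \<in> dpd_piece Dp Dm (int n)"
    unfolding dpd_piece_nonneg by blast
  then show "iota (Polynomial.monom 1 n) \<in> carrier (dpd_algebra Dp Dm)"
    using dpd_piece_subset_carrier by blast
  show "iota (Polynomial.monom 1 (Suc n)) = iota (Polynomial.monom 1 n) * iota (Polynomial.monom 1 1)"
    by (simp add: mult_monom flip: iota.hom_mult)
  show "range (\<lambda>p. iota (Polynomial.monom p n)) =
      range (\<lambda>c. Poly_Mapping.single 0 (to_fract c) * iota (Polynomial.monom 1 n))"
    by (simp add: iota_monom mult_single)
qed

text \<open>The map is \<open>iota\<close>; it is onto since each component of degree
  \<open>n >= 0\<close> is a polynomial multiple of \<open>(g u)^n\<close>.\<close>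

lemma graded_isomorphic_poly_algebra: "graded_isomorphic poly_algebra (nonneg_part (dpd_algebra Dp Dm))"
proof -
  have inj: "inj iota"
    by (intro injI) (metis iota.hom_minus iota_eq_0_iff eq_iff_diff_eq_0)
  have "iota s \<in> carrier (nonneg_part (dpd_algebra Dp Dm))" for s
    by (auto simp: dpd_algebra_def lookup_iota dpd_coeffs_nonneg mem_dpd_coeffs[of 0])
  moreover have "x \<in> range iota" if x: "x \<in> carrier (nonneg_part (dpd_algebra Dp Dm))" for x
  proof -
    have "\<exists>p. Poly_Mapping.single n (Poly_Mapping.lookup x n) = iota (Polynomial.monom p (nat n))"
      if "n \<in> Poly_Mapping.keys x" for n
    proof -
      have "0 \<le> n" using x that unfolding nonneg_part_simps in_keys_iff mem_Collect_eq by (metis not_le)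
      moreover have "Poly_Mapping.lookup x n \<in> dpd_coeffs Dp Dm n"
        using x by (simp add: dpd_algebra_def)
      ultimately show ?thesis by (auto simp: iota_monom dpd_coeffs_nonneg)
    qed
    then obtain p where p: "\<And>n. n \<in> Poly_Mapping.keys x \<Longrightarrow>
        Poly_Mapping.single n (Poly_Mapping.lookup x n) = iota (Polynomial.monom (p n) (nat n))"
      by metis
    have "x = (\<Sum>n\<in>Poly_Mapping.keys x. iota (Polynomial.monom (p n) (nat n)))"
      using laurent_eq_sum_single[of x] p by simp
    also have "\<dots> = iota (\<Sum>n\<in>Poly_Mapping.keys x. Polynomial.monom (p n) (nat n))"
      by (simp add: iota.hom_sum)
    finally show ?thesis by (rule range_eqI)
  qed
  ultimately have "bij_betw iota UNIV (carrier (nonneg_part (dpd_algebra Dp Dm)))"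
    unfolding bij_betw_def using inj by blast
  then have "iota \<in> ring_iso poly_algebra (nonneg_part (dpd_algebra Dp Dm))"
    by (auto simp: ring_iso_def bij_betw_def iota.hom_add iota.hom_mult simp del: nonneg_part_simps(6) intro!: ring_hom_memI)
  moreover have "iota (Polynomial.smult c s) = Poly_Mapping.single 0 (to_fract c) * iota s" for c s
    by (rule poly_mapping_eqI) (simp add: lookup_iota lookup_single_times)
  moreover have "iota ` gpart poly_algebra n = gpart (nonneg_part (dpd_algebra Dp Dm)) n" for n
    using dpd_piece_nonneg[of "nat n"] by (cases "0 \<le> n") (simp_all add: image_image)
  ultimately have "iota \<in> graded_algebra_iso poly_algebra (nonneg_part (dpd_algebra Dp Dm))"
    by (simp add: graded_algebra_iso_def del: nonneg_part_simps(5) poly_algebra_simps(5))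
  then show ?thesis unfolding graded_isomorphic_def by blast
qed

end

section \<open>The normal form for integral divisors and the equivalences\<close>

lemma integral_dpd_embedding:
  assumes le: "qdiv_le (Dp + Dm) 0" and int: "qdiv_frac Dp = 0"
  obtains g P d where "dpd_embedding g P d Dp Dm" "Polynomial.lead_coeff P = 1"
    "Dp + Dm = - qdiv_scale (1 / of_nat d) (principal_qdiv (to_fract P))"
proof -
  let ?E = "Dp + Dm"
  have Dp_int: "of_int \<lfloor>Poly_Mapping.lookup Dp a\<rfloor> = Poly_Mapping.lookup Dp a" for a
    using int by (simp add: qdiv_frac_eq_0_iff)
  have "{a. - \<lfloor>Poly_Mapping.lookup Dp a\<rfloor> \<noteq> 0} \<subseteq> Poly_Mapping.keys Dp"
    by (auto simp: in_keys_iff)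
  then have "finite {a. - \<lfloor>Poly_Mapping.lookup Dp a\<rfloor> \<noteq> 0}"
    by (rule finite_subset) simp
  then obtain g where g: "g \<noteq> 0" "\<And>a. ord_at a g = - \<lfloor>Poly_Mapping.lookup Dp a\<rfloor>"
    using exists_fract_with_orders by metis
  obtain d :: nat where d: "d \<noteq> 0" "\<And>a. a \<in> Poly_Mapping.keys ?E \<Longrightarrow> of_nat d * Poly_Mapping.lookup ?E a \<in> \<int>"
    using common_denominator[OF finite_keys, where q = "Poly_Mapping.lookup ?E"] by metis
  \<comment> \<open>By the choice of \<open>d\<close> and the sign of \<open>Dp + Dm\<close>, the
    divisor \<open>- d (Dp + Dm)\<close> is integral and effective, so neither the floor nor
    \<open>nat\<close> alters it.\<close>
  obtain P :: "complex poly" where P: "Polynomial.lead_coeff P = 1"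
    "\<And>a. Polynomial.order a P = (if a \<in> Poly_Mapping.keys ?E then nat \<lfloor>- (of_nat d * Poly_Mapping.lookup ?E a)\<rfloor> else 0)"
    using exists_monic_with_orders[OF finite_keys,
        where k = "\<lambda>a. nat \<lfloor>- (of_nat d * Poly_Mapping.lookup ?E a)\<rfloor>"] by blast
  have P0: "P \<noteq> 0" using P(1) by auto
  have order: "of_nat (Polynomial.order a P) = - (of_nat d * Poly_Mapping.lookup ?E a)" for a
  proof (cases "a \<in> Poly_Mapping.keys ?E")
    case True
    have "of_nat d * Poly_Mapping.lookup ?E a \<le> 0"
      using le by (intro mult_nonneg_nonpos) (simp_all add: qdiv_le_def)
    moreover have "- (of_nat d * Poly_Mapping.lookup ?E a) \<in> \<int>"
      using d(2)[OF True] by simp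
    ultimately show ?thesis using True by (simp add: P(2))
  qed (simp add: P(2) in_keys_iff)
  have E: "Poly_Mapping.lookup Dp a + Poly_Mapping.lookup Dm a = - (of_nat (Polynomial.order a P) / of_nat d)" for a
    unfolding order using d(1) by (simp add: lookup_add)
  show thesis
  proof
    show "dpd_embedding g P d Dp Dm"
    proof unfold_locales
      show "Poly_Mapping.lookup Dp a = - of_int (ord_at a g)" for a
        by (simp add: g(2) Dp_int)
      show "Poly_Mapping.lookup Dm a = of_int (ord_at a g) - of_nat (Polynomial.order a P) / of_nat d" for a
        using E[of a] by (simp add: g(2) Dp_int)
    qed (rule g(1) P0 d(1))+
    show "Dp + Dm = - qdiv_scale (1 / of_nat d) (principal_qdiv (to_fract P))"
      using P0 E by (intro poly_mapping_eqI)
        (simp add: lookup_add lookup_qdiv_scale lookup_principal_qdiv ord_at_to_fract)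
  qed (rule P(1))
qed

theorem proposition4p11:
  fixes Dp Dm :: qdivisor
  assumes "qdiv_le (Dp + Dm) 0"
  shows "(qdiv_frac Dp = 0 \<longleftrightarrow>
            graded_isomorphic (nonneg_part (dpd_algebra Dp Dm)) poly_algebra) \<and>
         (qdiv_frac Dp = 0 \<longleftrightarrow>
            (\<exists>(d::nat) (P::complex poly). 1 \<le> d \<and> Polynomial.lead_coeff P = 1 \<and>
               Dp + Dm = - qdiv_scale (1 / of_nat d) (principal_qdiv (to_fract P)) \<and>
               graded_isomorphic (dpd_algebra Dp Dm) (A_dP d P)))"
proof (intro conjI iffI)
  assume int: "qdiv_frac Dp = 0"
  obtain g P d where emb: "dpd_embedding g P d Dp Dm" and sum: "Polynomial.lead_coeff P = 1"
    "Dp + Dm = - qdiv_scale (1 / of_nat d) (principal_qdiv (to_fract P))"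
    by (rule integral_dpd_embedding[OF assms int])
  interpret dpd_embedding g P d Dp Dm by (rule emb)
  show "graded_isomorphic (nonneg_part (dpd_algebra Dp Dm)) poly_algebra"
    using graded_closed_poly_algebra graded_isomorphic_poly_algebra by (rule graded_isomorphic_sym)
  show "\<exists>(d::nat) (P::complex poly). 1 \<le> d \<and> Polynomial.lead_coeff P = 1 \<and>
      Dp + Dm = - qdiv_scale (1 / of_nat d) (principal_qdiv (to_fract P)) \<and>
      graded_isomorphic (dpd_algebra Dp Dm) (A_dP d P)"
    using sum d graded_isomorphic_A_dP by (intro exI[of _ d] exI[of _ P] conjI) auto
next
  assume "graded_isomorphic (nonneg_part (dpd_algebra Dp Dm)) poly_algebra"
  with graded_closed_nonneg_part[OF assms]
  have "graded_isomorphic poly_algebra (nonneg_part (dpd_algebra Dp Dm))"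
    by (rule graded_isomorphic_sym)
  then have "power_generated (nonneg_part (dpd_algebra Dp Dm))"
    using power_generated_poly_algebra by (rule power_generated_iso)
  \<comment> \<open>The property concerns only degrees \<open>n >= 0\<close>, where both algebras
    have the same pieces.\<close>
  then have "power_generated (dpd_algebra Dp Dm)"
    unfolding power_generated_def by auto
  then show "qdiv_frac Dp = 0" by (rule integral_of_power_generated)
next
  assume "\<exists>(d::nat) (P::complex poly). 1 \<le> d \<and> Polynomial.lead_coeff P = 1 \<and>
      Dp + Dm = - qdiv_scale (1 / of_nat d) (principal_qdiv (to_fract P)) \<and>
      graded_isomorphic (dpd_algebra Dp Dm) (A_dP d P)"
  then obtain d :: nat and P :: "complex poly" where dP: "1 \<le> d" "Polynomial.lead_coeff P = 1"
    "graded_isomorphic (dpd_algebra Dp Dm) (A_dP d P)"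
    by blast
  then have P: "P \<noteq> 0" by auto
  \<comment> \<open>Every \<open>A_dP d P\<close> arises from the pair \<open>0\<close> and
    \<open>- div P / d\<close>, with \<open>g = 1\<close>. This model shows that it is generated by
    powers, a property that then passes to the given algebra.\<close>
  interpret E: dpd_embedding 1 P d 0 "- qdiv_scale (1 / of_nat d) (principal_qdiv (to_fract P))"
    using P dP(1) by unfold_locales
      (simp_all add: lookup_qdiv_scale lookup_principal_qdiv ord_at_to_fract)
  have "power_generated (A_dP d P)"
    using E.graded_isomorphic_A_dP E.power_generated_dpd_algebra by (rule power_generated_iso)
  moreover have "graded_isomorphic (A_dP d P) (dpd_algebra Dp Dm)"
    using graded_closed_dpd_algebra[OF assms] dP(3) by (rule graded_isomorphic_sym)
  ultimately have "power_generated (dpd_algebra Dp Dm)"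
    by (metis power_generated_iso)
  then show "qdiv_frac Dp = 0" by (rule integral_of_power_generated)
qed

end
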